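(* Let $c$ be a transportation cost on $X$, $\hat P\in\mathcal P_c(X)$, $\rho>0$, $N\in\mathbb N$, and let $\ell:X^N\to\mathbb R$ be Borel measurable. Consider $$S(\ell)=\sup_{P\in\mathbb B^c_\rho(\hat P)}\int_{X^N}\ell\,dP^{\otimes N}.$$ (i) If $c$ satisfies the weak triangle inequality and $\ell\in\hat{\mathcal G}_{c,N}(X^N)$, then $S(\ell)<\infty$. (ii) If $c$ is proper, $\ell$ is upper semi-continuous and $\ell\in\hat{\mathcal G}^<_{c,N}(X^N)$, then the supremum is attained by some $P\in\mathbb B^c_\rho(\hat P)$.
   Context: $X$ is a nonempty Polish space. A transportation cost is a lower semi-continuous symmetric $c:X\times X\to[0,\infty)$ with $c(x,x)=0$; $W_c$ is the associated optimal transport cost. Weak triangle inequality: $\exists K>0$, $c(x,y)\le K(c(x,z)+c(z,y))$. $\mathcal P_c(X)=\{P:\int c(x_0,\cdot)dP<\infty\}$. $c$ is proper if it satisfies the weak triangle inequality and all sublevel sets $\{x:c(x_0,x)\le r\}$ are compact. $\mathbb B^c_\rho(\hat P)=\{P\in\mathcal P_c(X):W_c(P,\hat P)\le\rho\}$. $\mathcal D$: functions $\delta:[0,\infty)\to[0,\infty)$ with $\delta(r)\le r$ and $\delta(r)/r\to0$ as $r\to\infty$. $\hat{\mathcal G}_{c,N}(X^N)$ is the set of $\ell:X^N\to\mathbb R$ for which there are $C>0$, $x_0\in X$ with $\ell(x)\le C\prod_{k=1}^N(1+c(x_0,x_k))$ for all $x\in X^N$; $\hat{\mathcal G}^<_{c,N}(X^N)$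 is the set of $\ell$ for which there are $C>0$, $\delta\in\mathcal D$, $x_0\in X$ with $\ell(x)\le C\prod_{k=1}^N(1+\delta(c(x_0,x_k)))$ for all $x$. *)

theory Defs
  imports "HOL-Analysis.Analysis" "HOL-Probability.Probability"
begin

definition lsc_cost :: "('a::topological_space \<Rightarrow> 'a \<Rightarrow> real) \<Rightarrow> bool" where
  "lsc_cost c \<longleftrightarrow> (\<forall>t. closed {z :: 'a \<times> 'a. c (fst z) (snd z) \<le> t})"

definition transport_cost :: "('a::topological_space \<Rightarrow> 'a \<Rightarrow> real) \<Rightarrow> bool" where
  "transport_cost c \<longleftrightarrow> lsc_cost c \<and> (\<forall>x y. 0 \<le> c x y) \<and> (\<forall>x y. c x y = c y x) \<and> (\<forall>x. c x x = 0)"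

definition weak_triangle :: "('a \<Rightarrow> 'a \<Rightarrow> real) \<Rightarrow> bool" where
  "weak_triangle c \<longleftrightarrow> (\<exists>K>0. \<forall>x y z. c x y \<le> K * (c x z + c z y))"

definition proper_cost :: "('a::topological_space \<Rightarrow> 'a \<Rightarrow> real) \<Rightarrow> bool" where
  "proper_cost c \<longleftrightarrow> weak_triangle c \<and> (\<forall>x0 r. compact {x. c x0 x \<le> r})"

definition prob_borel :: "'a::topological_space measure set" where
  "prob_borel = {P. prob_space P \<and> sets P = sets borel}"

definition couplings :: "'a::topological_space measure \<Rightarrow> 'a measure \<Rightarrow> ('a \<times> 'a) measure set" where
  "couplings P Q = {\<pi>. prob_space \<pi> \<and> sets \<pi> = sets (borel :: ('a \<times> 'a) measure)
      \<and> distr \<pi> borel fst = P \<and> distr \<pi> borel snd = Q}"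

definition W_cost :: "('a::topological_space \<Rightarrow> 'a \<Rightarrow> real) \<Rightarrow> 'a measure \<Rightarrow> 'a measure \<Rightarrow> ennreal" where
  "W_cost c P Q = (INF \<pi>\<in>couplings P Q. \<integral>\<^sup>+ z. ennreal (c (fst z) (snd z)) \<partial>\<pi>)"

definition P_c :: "('a::topological_space \<Rightarrow> 'a \<Rightarrow> real) \<Rightarrow> 'a measure set" where
  "P_c c = {P \<in> prob_borel. \<exists>x0. (\<integral>\<^sup>+ x. ennreal (c x0 x) \<partial>P) < \<infinity>}"

definition W_ball :: "('a::topological_space \<Rightarrow> 'a \<Rightarrow> real) \<Rightarrow> real \<Rightarrow> 'a measure \<Rightarrow> 'a measure set" where
  "W_ball c \<rho> Phat = {P \<in> P_c c. W_cost c P Phat \<le> ennreal \<rho>}"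

definition D_class :: "(real \<Rightarrow> real) set" where
  "D_class = {\<delta>. (\<forall>r\<ge>0. 0 \<le> \<delta> r \<and> \<delta> r \<le> r) \<and> ((\<lambda>r. \<delta> r / r) \<longlongrightarrow> 0) at_top}"

text \<open>Growth classes on X^N, where X^N is modelled as functions from a finite type 'n with CARD('n) = N.\<close>

definition G_hat :: "('a \<Rightarrow> 'a \<Rightarrow> real) \<Rightarrow> (('n::finite \<Rightarrow> 'a) \<Rightarrow> real) set" where
  "G_hat c = {l. \<exists>C>0. \<exists>x0. \<forall>x. l x \<le> C * (\<Prod>k\<in>UNIV. 1 + c x0 (x k))}"

definition G_hat_lt :: "('a \<Rightarrow> 'a \<Rightarrow> real) \<Rightarrow> (('n::finite \<Rightarrow> 'a) \<Rightarrow> real) set" where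
  "G_hat_lt c = {l. \<exists>C>0. \<exists>\<delta>\<in>D_class. \<exists>x0. \<forall>x. l x \<le> C * (\<Prod>k\<in>UNIV. 1 + \<delta> (c x0 (x k)))}"

definition usc :: "('b::topological_space \<Rightarrow> real) \<Rightarrow> bool" where
  "usc f \<longleftrightarrow> (\<forall>t. closed {x. t \<le> f x})"

text \<open>Extended-valued integral: positive part minus negative part, in ereal.
  Convention: if the positive part has infinite integral the value is \<infinity>
  (in ereal, \<infinity> - x = \<infinity>). For integrable f it is the Lebesgue integral.\<close>

definition qint :: "'b measure \<Rightarrow> ('b \<Rightarrow> real) \<Rightarrow> ereal" where
  "qint M f = enn2ereal (\<integral>\<^sup>+ x. ennreal (f x) \<partial>M) - enn2ereal (\<integral>\<^sup>+ x. ennreal (- f x) \<partial>M)"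

definition S_val :: "('a::topological_space \<Rightarrow> 'a \<Rightarrow> real) \<Rightarrow> real \<Rightarrow> 'a measure \<Rightarrow> (('n::finite \<Rightarrow> 'a) \<Rightarrow> real) \<Rightarrow> ereal" where
  "S_val c \<rho> Phat l = (SUP P\<in>W_ball c \<rho> Phat. qint (Pi\<^sub>M UNIV (\<lambda>_::'n. P)) l)"

end

theory Submission
  imports Defs
begin

text \<open>The weak triangle inequality bounds the \<open>c\<close>-moment of every \<open>P\<close> in the ball by a common \<open>R\<close>, so the
  integrals of the majorants of \<open>l\<close> are bounded by \<open>C * (1 + R) ^ N\<close>; this is part (i).
  For part (ii) take near-optimal couplings \<open>\<pi>\<^sub>n\<close> of a maximizing sequence \<open>P\<^sub>n\<close> with \<open>Phat\<close>. Properness of \<open>c\<close>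
  makes them tight, and a subsequence is realized by random variables that converge almost surely.
  The limiting coupling then has cost at most \<open>\<rho>\<close> by Fatou's lemma. On the product space the
  integrands \<open>l\<close> are upper semicontinuous along the sequence, and the sublinearity of \<open>\<delta>\<close> makes their
  positive parts uniformly integrable, so the reverse Fatou lemma gives optimality of the limit.\<close>

section \<open>Almost surely convergent realizations of tight sequences\<close>

text \<open>A Polish space carrying a tight sequence is encoded in the real line by ternary expansions whose digits
  record membership in the balls of a countable base. The inverse of the code is continuous along sequences
  in the compact sets, so Helly's and Skorohod's theorems transfer from the reals.\<close>

definition ternary :: "(nat \<Rightarrow> bool) \<Rightarrow> real" where
  "ternary b = (\<Sum>j. of_bool (b j) / 3 ^ Suc j)"

lemma summable_ternary: "summable (\<lambda>j. of_bool (b j) / 3 ^ Suc j :: real)"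
proof (rule summable_comparison_test')
  show "summable (\<lambda>j. (1/3) ^ Suc j :: real)"
    unfolding summable_Suc_iff by (rule summable_geometric) simp
qed (auto simp: power_one_over divide_simps)

text \<open>All digits are at most 1, so the value stays at or below 1/2. This bound lets the floor
  split off an integer part, and it produces the gaps between codes.\<close>

lemma ternary_bounds: "0 \<le> ternary b" "ternary b \<le> 1/2"
proof -
  show "0 \<le> ternary b"
    unfolding ternary_def by (intro suminf_nonneg summable_ternary) auto
  have "(\<lambda>j. (1/3) * (1/3) ^ j :: real) sums ((1/3) * (1 / (1 - 1/3)))"
    by (intro sums_mult geometric_sums) simp
  then have *: "(\<lambda>j. (1/3) ^ Suc j :: real) sums (1/2)"
    by (simp add: power_Suc)
  have "ternary b \<le> (\<Sum>j. (1/3) ^ Suc j)"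
    unfolding ternary_def
    by (intro suminf_le summable_ternary sums_summable[OF *]) (auto simp: power_one_over divide_simps)
  then show "ternary b \<le> 1/2"
    using sums_unique[OF *] by simp
qed

lemma ternary_Suc: "3 * ternary b = of_bool (b 0) + ternary (\<lambda>j. b (Suc j))"
proof -
  have "3 * ternary b = (\<Sum>j. of_bool (b j) / 3 ^ j)"
    unfolding ternary_def by (subst suminf_mult[OF summable_ternary, symmetric]) simp
  also have "\<dots> = (\<Sum>j. of_bool (b (Suc j)) / 3 ^ Suc j) + of_bool (b 0)"
    using summable_mult[OF summable_ternary[of b], of 3]
    by (subst suminf_split_head) simp_all
  finally show ?thesis
    by (simp add: ternary_def)
qed

text \<open>Each multiplication by 3 moves one digit in front of the point, and the code of the
  shifted digit sequence remains behind it.\<close>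

lemma ternary_shift: "\<exists>n::int. 3 ^ k * (of_int m + ternary b) = of_int n + ternary (\<lambda>j. b (j + k))"
proof (induction k)
  case (Suc k)
  then obtain n :: int where n: "3 ^ k * (of_int m + ternary b) = of_int n + ternary (\<lambda>j. b (j + k))" ..
  have "3 ^ Suc k * (of_int m + ternary b) = 3 * of_int n + 3 * ternary (\<lambda>j. b (j + k))"
    using n by simp
  also have "\<dots> = of_int (3 * n + of_bool (b k)) + ternary (\<lambda>j. b (j + Suc k))"
    by (simp add: ternary_Suc)
  finally show ?case ..
qed (rule exI[of _ m], simp)

lemma floor_int_plus_ternary: "\<lfloor>of_int n + ternary b\<rfloor> = n"
  using ternary_bounds[of b] by (intro floor_unique) auto

text \<open>After scaling, digit \<open>k\<close> is the unit digit: \<open>m\<close> and the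
  earlier digits contribute multiples of 3, and the later digits at most 1/2, which the floor
  removes. The exponent is \<open>Suc k\<close> because digit 0 has weight 1/3.\<close>

lemma ternary_digit: "\<lfloor>3 ^ Suc k * (of_int m + ternary b)\<rfloor> mod 3 = of_bool (b k)"
proof -
  obtain n :: int where n: "3 ^ k * (of_int m + ternary b) = of_int n + ternary (\<lambda>j. b (j + k))"
    using ternary_shift by blast
  have "3 ^ Suc k * (of_int m + ternary b) = 3 * of_int n + 3 * ternary (\<lambda>j. b (j + k))"
    using n by simp
  also have "\<dots> = of_int (3 * n + of_bool (b k)) + ternary (\<lambda>j. b (Suc (j + k)))"
    by (simp add: ternary_Suc)
  finally have "\<lfloor>3 ^ Suc k * (of_int m + ternary b)\<rfloor> = 3 * n + of_bool (b k)"
    by (metis floor_int_plus_ternary)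
  then show ?thesis by simp
qed

text \<open>The digits 0 and 1 leave gaps in the ternary expansion, so leading digits are locally constant.\<close>
lemma ternary_floor_eq:
  assumes "x = of_int m + ternary b" "x' = of_int m' + ternary b'" "3 ^ k * \<bar>x - x'\<bar> < 1/2"
  shows "\<lfloor>3 ^ k * x\<rfloor> = \<lfloor>3 ^ k * x'\<rfloor>"
proof -
  obtain n :: int where n: "3 ^ k * x = of_int n + ternary (\<lambda>j. b (j + k))"
    using ternary_shift assms(1) by blast
  obtain n' :: int where n': "3 ^ k * x' = of_int n' + ternary (\<lambda>j. b' (j + k))"
    using ternary_shift assms(2) by blast
  have "\<bar>3 ^ k * x - 3 ^ k * x'\<bar> < 1/2"
    using assms(3) by (simp add: abs_mult flip: right_diff_distrib)
  \<comment> \<open>Both remainders lie in [0, 1/2] and the two numbers are less than 1/2 apart, so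
    these integers differ by less than 1.\<close>
  then have "n = n'"
    using n n' ternary_bounds[of "\<lambda>j. b (j + k)"] ternary_bounds[of "\<lambda>j. b' (j + k)"] by linarith
  then show ?thesis
    by (simp add: n n' floor_int_plus_ternary)
qed

section \<open>Borel coding of a Polish space by reals\<close>

text \<open>The limit need not exist everywhere, so the sequence is replaced by a constant where it
  is not Cauchy. By completeness the modified sequence converges everywhere, which makes its limit
  measurable.\<close>

lemma borel_measurable_lim_complete:
  fixes f :: "nat \<Rightarrow> 'a \<Rightarrow> 'b::{complete_space, second_countable_topology}"
  assumes [measurable]: "\<And>i. f i \<in> borel_measurable M"
  obtains g where "g \<in> borel_measurable M"
    "\<And>x. convergent (\<lambda>i. f i x) \<Longrightarrow> (\<lambda>i. f i x) \<longlonglongrightarrow> g x"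
proof
  define h where "h i x = (if Cauchy (\<lambda>i. f i x) then f i x else undefined)" for i x
  have [measurable]: "h i \<in> borel_measurable M" for i
    unfolding h_def by measurable
  have h: "convergent (\<lambda>i. h i x)" for x
    unfolding h_def by (cases "Cauchy (\<lambda>i. f i x)") (simp_all add: Cauchy_convergent convergent_const)
  show "(\<lambda>x. lim (\<lambda>i. h i x)) \<in> borel_measurable M"
    by (rule borel_measurable_LIMSEQ_metric[of h]) (use h in \<open>simp_all only: convergent_LIMSEQ_iff, measurable\<close>)
  show "(\<lambda>i. f i x) \<longlonglongrightarrow> lim (\<lambda>i. h i x)" if "convergent (\<lambda>i. f i x)" for x
  proof -
    have "Cauchy (\<lambda>i. f i x)"
      using that by (rule convergent_Cauchy)
    then show ?thesis
      using that unfolding h_def convergent_LIMSEQ_iff by simp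
  qed
qed

text \<open>On the union of the \<open>K m\<close>, the integer part of \<open>s z\<close> names a
  compact set containing \<open>z\<close>, and the digits tell which balls of a countable base
  contain \<open>z\<close>. Convergence of codes freezes the compact set and each digit, which
  forces the points to converge.\<close>

lemma borel_coding:
  fixes K :: "nat \<Rightarrow> 'b::{complete_space, second_countable_topology} set"
  assumes K: "\<And>m. compact (K m)"
  obtains s :: "'b \<Rightarrow> real" and \<phi> :: "real \<Rightarrow> 'b"
  where "s \<in> borel_measurable borel" "\<phi> \<in> borel_measurable borel" "\<And>z. \<phi> (s z) = z"
    "\<And>z. 0 \<le> s z" "\<And>z m. z \<in> K m \<Longrightarrow> s z \<le> real m + 1"
    "\<And>z y. range z \<subseteq> (\<Union>m. K m) \<Longrightarrow> (\<lambda>n. s (z n)) \<longlonglongrightarrow> y \<Longrightarrow> convergent z"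
proof -
  obtain D :: "'b set" where D: "countable D" "\<And>U. open U \<Longrightarrow> U \<noteq> {} \<Longrightarrow> \<exists>y\<in>D. y \<in> U"
    using countable_dense_exists by blast
  have "D \<noteq> {}"
    using D(2)[of UNIV] by auto
  define d where "d = from_nat_into D"
  have d: "\<exists>i. dist z (d i) < e" if "e > 0" for z e
  proof -
    obtain y where "y \<in> D" "y \<in> ball z e"
      using D(2)[of "ball z e"] \<open>e > 0\<close> by auto
    then show ?thesis
      using from_nat_into_surj[OF \<open>countable D\<close>] by (auto simp: d_def)
  qed
  define b where "b z k = (case prod_decode k of (i, j) \<Rightarrow> dist z (d i) < inverse (real (Suc j)))" for z k
  \<comment> \<open>Outside all \<open>K m\<close> this is an unspecified natural number; the code
    is still nonnegative and decodable there.\<close>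
  define M where "M z = (LEAST m. z \<in> K m)" for z
  define s where "s z = of_int (int (M z)) + ternary (b z)" for z
  \<comment> \<open>The first centre whose ball of radius \<open>inverse (real (Suc j))\<close> has
    digit 1. For \<open>y = s z\<close> it lies within that radius of \<open>z\<close>, so these
    centres converge to \<open>z\<close>.\<close>
  define a where "a j y = d (LEAST i. \<lfloor>3 ^ Suc (prod_encode (i, j)) * y\<rfloor> mod 3 = 1)" for j and y :: real
  have digit: "\<lfloor>3 ^ Suc (prod_encode (i, j)) * s z\<rfloor> mod 3 = 1 \<longleftrightarrow> dist z (d i) < inverse (real (Suc j))" for i j z
    unfolding s_def ternary_digit by (simp add: b_def)
  have a[measurable]: "a j \<in> borel_measurable borel" for j
    unfolding a_def by measurable
  then obtain \<phi> where \<phi>: "\<phi> \<in> borel_measurable borel"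
      "\<And>y. convergent (\<lambda>j. a j y) \<Longrightarrow> (\<lambda>j. a j y) \<longlonglongrightarrow> \<phi> y"
    using borel_measurable_lim_complete[of a borel] by blast
  show thesis
  proof
    have [measurable]: "K m \<in> sets borel" for m
      using K by (intro borel_closed compact_imp_closed)
    have [measurable]: "M \<in> borel \<rightarrow>\<^sub>M count_space UNIV"
      unfolding M_def by measurable
    have [measurable]: "(\<lambda>z. b z k) \<in> borel \<rightarrow>\<^sub>M count_space UNIV" for k
      unfolding b_def by (cases "prod_decode k") simp
    show "s \<in> borel_measurable borel"
      unfolding s_def ternary_def by measurable
    show "\<phi> \<in> borel_measurable borel" by (rule \<phi>)
    show "\<phi> (s z) = z" for z
    proof -
      have "dist z (a j (s z)) < inverse (real (Suc j))" for j
        unfolding a_def digit by (rule LeastI_ex) (rule d, simp)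
      then have "(\<lambda>j. a j (s z)) \<longlonglongrightarrow> z"
        by (intro metric_tendsto_imp_tendsto[OF LIMSEQ_inverse_real_of_nat])
           (auto simp: dist_commute less_imp_le intro!: always_eventually)
      then show ?thesis
        by (intro LIMSEQ_unique[OF \<phi>(2)]) (auto intro: convergentI)
    qed
    show "0 \<le> s z" for z
      using ternary_bounds[of "b z"] by (simp add: s_def)
    show "s z \<le> real m + 1" if "z \<in> K m" for z m
      using ternary_bounds[of "b z"] Least_le[of "\<lambda>m. z \<in> K m", OF that] by (simp add: s_def M_def)
    show "convergent z" if z: "range z \<subseteq> (\<Union>m. K m)" and y: "(\<lambda>n. s (z n)) \<longlonglongrightarrow> y" for z y
    proof -
      have const: "\<exists>n0. \<forall>n\<ge>n0. \<forall>n'\<ge>n0. \<lfloor>3 ^ k * s (z n)\<rfloor> = \<lfloor>3 ^ k * s (z n')\<rfloor>" for k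
      proof -
        have "Cauchy (\<lambda>n. s (z n))"
          using y by (rule LIMSEQ_imp_Cauchy)
        then obtain n0 where "\<forall>n\<ge>n0. \<forall>n'\<ge>n0. dist (s (z n)) (s (z n')) < 1 / (2 * 3 ^ k)"
          unfolding Cauchy_def by (metis divide_pos_pos mult_pos_pos zero_less_numeral zero_less_one zero_less_power)
        then show ?thesis
          by (intro exI[of _ n0] allI impI ternary_floor_eq[OF s_def s_def])
             (auto simp: dist_real_def field_simps)
      qed
      have floor_s: "\<lfloor>s w\<rfloor> = int (M w)" for w
        unfolding s_def by (rule floor_int_plus_ternary)
      \<comment> \<open>For \<open>k = 0\<close> the floors are the numbers \<open>M (z n)\<close>,
        so from \<open>n0\<close> on the sequence stays in a single compact set.\<close>
      obtain n0 where n0: "\<And>n. n \<ge> n0 \<Longrightarrow> M (z n) = M (z n0)"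
        using const[of 0] unfolding power_0 mult_1 floor_s of_nat_eq_iff by blast
      have zK: "z n \<in> K (M (z n))" for n
        unfolding M_def by (rule LeastI_ex) (use z in blast)
      have "\<forall>n. z (n + n0) \<in> K (M (z n0))"
        using zK n0 by (metis le_add2)
      moreover have "seq_compact (K (M (z n0)))"
        using K compact_eq_seq_compact_metric by blast
      ultimately obtain w r where r: "strict_mono r" "((\<lambda>n. z (n + n0)) \<circ> r) \<longlonglongrightarrow> w"
        by (elim seq_compactE)
      \<comment> \<open>The subsequence enters a small ball around some \<open>d i\<close> near
        \<open>w\<close>. The digit of that ball is eventually constant along the whole sequence,
        hence eventually 1, so every late \<open>z n\<close> is close to \<open>d i\<close> and thus
        to \<open>w\<close>.\<close>
      have "z \<longlonglongrightarrow> w"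
      proof (rule metric_LIMSEQ_I)
        fix e :: real assume "e > 0"
        then obtain j where j: "inverse (real (Suc j)) < e / 2"
          using reals_Archimedean half_gt_zero by blast
        obtain i where i: "dist w (d i) < inverse (real (Suc j))"
          using d[of "inverse (real (Suc j))" w] by auto
        define \<epsilon> where "\<epsilon> = inverse (real (Suc j)) - dist w (d i)"
        have "\<epsilon> > 0" using i by (simp add: \<epsilon>_def)
        obtain n1 where n1: "\<And>n n'. n \<ge> n1 \<Longrightarrow> n' \<ge> n1 \<Longrightarrow>
            \<lfloor>3 ^ Suc (prod_encode (i, j)) * s (z n)\<rfloor> = \<lfloor>3 ^ Suc (prod_encode (i, j)) * s (z n')\<rfloor>"
          using const by blast
        obtain n2 where n2: "\<And>n. n \<ge> n2 \<Longrightarrow> dist (z (r n + n0)) w < \<epsilon>"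
          using metric_LIMSEQ_D[OF r(2) \<open>\<epsilon> > 0\<close>] by auto
        define p where "p = r (max n1 n2) + n0"
        have "p \<ge> n1"
          using seq_suble[OF r(1), of "max n1 n2"] by (simp add: p_def)
        have "dist (z p) (d i) < inverse (real (Suc j))"
          using n2[of "max n1 n2"] dist_triangle[of "z p" "d i" w] by (simp add: p_def \<epsilon>_def)
        then have "dist (z n) (d i) < inverse (real (Suc j))" if "n \<ge> n1" for n
          using n1[OF that \<open>p \<ge> n1\<close>] digit by metis
        then have "dist (z n) w < e" if "n \<ge> n1" for n
          using that i j dist_triangle2[of "z n" w "d i"] by fastforce
        then show "\<exists>no. \<forall>n\<ge>no. dist (z n) w < e"
          by blast
      qed
      then show ?thesis by (rule convergentI)
    qed
  qed
qed

section \<open>Almost sure realization of tight sequences\<close>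

text \<open>The images of the \<open>\<mu> n\<close> under \<open>s\<close> are tight on the real
  line, where Helly and Skorohod give a convergent sequence \<open>Y n\<close>. Decoding it yields
  variables with the laws \<open>\<mu> (r n)\<close>, whose codes are almost surely the
  \<open>Y n\<close>, so the decoded sequence converges too.\<close>

lemma prokhorov_skorohod:
  fixes \<mu> :: "nat \<Rightarrow> 'b::{complete_space, second_countable_topology} measure"
  assumes prob: "\<And>n. prob_space (\<mu> n)" and sets: "\<And>n. sets (\<mu> n) = sets borel"
    and tight: "\<And>e. 0 < e \<Longrightarrow> \<exists>K. compact K \<and> (\<forall>n. measure (\<mu> n) (- K) < e)"
  obtains r :: "nat \<Rightarrow> nat" and \<Omega> :: "real measure" and Z Z'
  where "strict_mono r" "prob_space \<Omega>"
    "\<And>n. Z n \<in> borel_measurable \<Omega>" "Z' \<in> borel_measurable \<Omega>"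
    "\<And>n. distr \<Omega> borel (Z n) = \<mu> (r n)" "AE \<omega> in \<Omega>. (\<lambda>n. Z n \<omega>) \<longlonglongrightarrow> Z' \<omega>"
proof -
  have "\<forall>m. \<exists>K. compact K \<and> (\<forall>n. measure (\<mu> n) (- K) < inverse (real (Suc m)))"
    using tight by simp
  then obtain K where K: "\<And>m. compact (K m)"
      "\<And>m n. measure (\<mu> n) (- K m) < inverse (real (Suc m))"
    by metis
  obtain s :: "'b \<Rightarrow> real" and \<phi> :: "real \<Rightarrow> 'b"
    where [measurable]: "s \<in> borel_measurable borel" "\<phi> \<in> borel_measurable borel"
      and \<phi>: "\<And>z. \<phi> (s z) = z" and s: "\<And>z. 0 \<le> s z" "\<And>z m. z \<in> K m \<Longrightarrow> s z \<le> real m + 1"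
      and conv: "\<And>z y. range z \<subseteq> (\<Union>m. K m) \<Longrightarrow> (\<lambda>n. s (z n)) \<longlonglongrightarrow> y \<Longrightarrow> convergent z"
    by (rule borel_coding[OF K(1)]) (rule that)
  have [measurable]: "K m \<in> sets borel" for m
    using K by (intro borel_closed compact_imp_closed)
  note sets[measurable_cong]
  have space: "space (\<mu> n) = UNIV" for n
    using sets_eq_imp_space_eq[OF sets[of n]] by simp
  interpret \<mu>: prob_space "\<mu> n" for n by (rule prob)
  define \<nu> where "\<nu> n = distr (\<mu> n) borel s" for n
  have \<nu>: "real_distribution (\<nu> n)" for n
    unfolding \<nu>_def by (rule \<mu>.real_distribution_distr) measurable
  have "tight \<nu>"
    unfolding tight_def
  proof (intro conjI allI impI \<nu>)
    fix e :: real assume "0 < e"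
    then obtain m where m: "inverse (real (Suc m)) < e"
      using reals_Archimedean by blast
    \<comment> \<open>The left endpoint is negative because the interval is open there and codes may
      be 0.\<close>
    have "1 - e < measure (\<nu> n) {-1<..real m + 1}" for n
    proof -
      have "1 - e < 1 - measure (\<mu> n) (- K m)"
        using K(2)[of n m] m by linarith
      also have "\<dots> = measure (\<mu> n) (K m)"
        using \<mu>.prob_compl[of "K m" n] by (simp add: space Compl_eq_Diff_UNIV)
      also have "\<dots> \<le> measure (\<mu> n) (s -` {-1<..real m + 1} \<inter> space (\<mu> n))"
      proof (rule \<mu>.finite_measure_mono)
        have "- 1 < s z" for z
          using s(1)[of z] by linarith
        then show "K m \<subseteq> s -` {-1<..real m + 1} \<inter> space (\<mu> n)"
          using s(2) by (auto simp: space)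
      qed measurable
      also have "\<dots> = measure (\<nu> n) {-1<..real m + 1}"
        unfolding \<nu>_def by (subst measure_distr) auto
      finally show ?thesis .
    qed
    then show "\<exists>a b. a < b \<and> (\<forall>n. 1 - e < measure (\<nu> n) {a<..b})"
      by (intro exI[of _ "-1"] exI[of _ "real m + 1"]) auto
  qed
  then obtain r M where r: "strict_mono r" and M: "real_distribution M" "weak_conv_m (\<nu> \<circ> id \<circ> r) M"
    using tight_imp_convergent_subsubsequence[of \<nu> id] strict_mono_id by (auto simp: id_def)
  have "real_distribution ((\<nu> \<circ> id \<circ> r) n)" for n
    using \<nu> by simp
  from Skorohod[OF this M]
  obtain \<Omega> :: "real measure" and Y Y'
    where \<Omega>: "prob_space \<Omega>" and Y: "\<forall>n. Y n \<in> borel_measurable \<Omega>"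
      and "\<forall>n. distr \<Omega> borel (Y n) = (\<nu> \<circ> id \<circ> r) n"
      and lim_Y: "\<forall>x\<in>space \<Omega>. (\<lambda>n. Y n x) \<longlonglongrightarrow> Y' x"
    by (elim exE conjE) (rule that; assumption)
  have [measurable]: "Y n \<in> borel_measurable \<Omega>" for n
    using Y ..
  have distr_Y: "distr \<Omega> borel (Y n) = distr (\<mu> (r n)) borel s" for n
    using \<open>\<forall>n. distr \<Omega> borel (Y n) = (\<nu> \<circ> id \<circ> r) n\<close> by (simp add: \<nu>_def)
  have Z: "(\<lambda>\<omega>. \<phi> (Y n \<omega>)) \<in> borel_measurable \<Omega>" for n
    by measurable
  \<comment> \<open>Since \<open>\<phi>\<close> is only Borel, \<open>\<phi> (Y' \<omega>)\<close>
    need not be the limit; \<open>Z'\<close> is therefore taken as a limit function of the decoded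
    sequence.\<close>
  then obtain Z' where Z': "Z' \<in> borel_measurable \<Omega>"
      "\<And>x. convergent (\<lambda>n. \<phi> (Y n x)) \<Longrightarrow> (\<lambda>n. \<phi> (Y n x)) \<longlonglongrightarrow> Z' x"
    by (rule borel_measurable_lim_complete[of "\<lambda>n \<omega>. \<phi> (Y n \<omega>)"]) (use that in blast)
  have AE_K: "AE z in \<mu> n. z \<in> (\<Union>m. K m)" for n
  proof (rule \<mu>.AE_prob_1, rule antisym)
    show "1 \<le> measure (\<mu> n) (\<Union>m. K m)"
    proof (rule field_le_epsilon)
      fix e :: real assume "0 < e"
      then obtain m where m: "inverse (real (Suc m)) < e"
        using reals_Archimedean by blast
      have "1 - measure (\<mu> n) (- K m) = measure (\<mu> n) (K m)"
        using \<mu>.prob_compl[of "K m" n] by (simp add: space Compl_eq_Diff_UNIV)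
      also have "\<dots> \<le> measure (\<mu> n) (\<Union>m. K m)"
        by (intro \<mu>.finite_measure_mono) auto
      finally show "1 \<le> measure (\<mu> n) (\<Union>m. K m) + e"
        using K(2)[of n m] m by linarith
    qed
  qed simp
  \<comment> \<open>The event depends only on the law of \<open>Y n\<close>, which is the image of
    \<open>\<mu> (r n)\<close> under \<open>s\<close>, so it can be checked on points of the form
    \<open>s z\<close>.\<close>
  have "AE \<omega> in \<Omega>. s (\<phi> (Y n \<omega>)) = Y n \<omega> \<and> \<phi> (Y n \<omega>) \<in> (\<Union>m. K m)" for n
  proof -
    have "AE y in distr (\<mu> (r n)) borel s. s (\<phi> y) = y \<and> \<phi> y \<in> (\<Union>m. K m)"
      using AE_K[of "r n"] by (subst AE_distr_iff) (simp_all add: \<phi>)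
    then have "AE y in distr \<Omega> borel (Y n). s (\<phi> y) = y \<and> \<phi> y \<in> (\<Union>m. K m)"
      by (simp only: distr_Y)
    then show ?thesis
      by (subst (asm) AE_distr_iff) simp_all
  qed
  then have "AE \<omega> in \<Omega>. \<forall>n. s (\<phi> (Y n \<omega>)) = Y n \<omega> \<and> \<phi> (Y n \<omega>) \<in> (\<Union>m. K m)"
    unfolding AE_all_countable by blast
  then have "AE \<omega> in \<Omega>. (\<lambda>n. \<phi> (Y n \<omega>)) \<longlonglongrightarrow> Z' \<omega>"
    using AE_space
  proof eventually_elim
    case (elim \<omega>)
    then have "convergent (\<lambda>n. \<phi> (Y n \<omega>))"
      using lim_Y by (intro conv[of _ "Y' \<omega>"]) auto
    then show ?case by (rule Z')
  qed
  moreover have "distr \<Omega> borel (\<lambda>\<omega>. \<phi> (Y n \<omega>)) = \<mu> (r n)" for n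
  proof -
    have "distr \<Omega> borel (\<lambda>\<omega>. \<phi> (Y n \<omega>)) = distr (distr \<Omega> borel (Y n)) borel \<phi>"
      by (simp add: distr_distr comp_def)
    also have "\<dots> = distr (\<mu> (r n)) borel (\<lambda>z. z)"
      unfolding distr_Y by (simp add: distr_distr comp_def \<phi>)
    also have "\<dots> = \<mu> (r n)"
      by (rule distr_id2) (simp add: sets)
    finally show ?thesis .
  qed
  ultimately show thesis
    by (intro that[OF r \<Omega> Z Z'(1)])
qed

section \<open>Laws of almost sure limits\<close>

text \<open>The indicator of a nonempty closed set is the pointwise limit of continuous cut-offs of
  the distance to it, and closed sets form an intersection-stable generator of the Borel
  sets.\<close>

lemma prob_measure_eqI_continuous:
  fixes M N :: "'a::metric_space measure"
  assumes M: "prob_space M" "sets M = sets borel" and N: "prob_space N" "sets N = sets borel"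
    and eq: "\<And>h. continuous_on UNIV h \<Longrightarrow> (\<And>x. 0 \<le> h x \<and> h x \<le> 1) \<Longrightarrow> integral\<^sup>L M h = (integral\<^sup>L N h :: real)"
  shows "M = N"
proof -
  interpret M: prob_space M by fact
  interpret N: prob_space N by fact
  have closed_eq: "emeasure M F = emeasure N F" if F: "closed F" for F
  \<comment> \<open>The distance \<open>infdist\<close> to the empty set is 0 by convention, so the
    cut-offs would converge to 1 instead of 0.\<close>
  proof (cases "F = {}")
    case False
    define h where "h k x = max 0 (1 - real k * infdist x F)" for k x
    have cont: "continuous_on UNIV (h k)" for k
      unfolding h_def by (intro continuous_intros)
    have h01: "0 \<le> h k x \<and> h k x \<le> 1" for k x
      by (auto simp: h_def infdist_nonneg)
    have lim: "(\<lambda>k. h k x) \<longlonglongrightarrow> indicator F x" for x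
    proof (cases "x \<in> F")
      case True
      then have "h k x = 1" for k by (simp add: h_def)
      then show ?thesis using True by simp
    next
      case x: False
      then have "infdist x F > 0"
        using in_closed_iff_infdist_zero[OF F False] infdist_nonneg[of x F] by (auto simp: less_le)
      then obtain k0 where k0: "1 < real k0 * infdist x F"
        using reals_Archimedean3 by blast
      have "h k x = 0" if "k \<ge> k0" for k
      proof -
        have "real k0 * infdist x F \<le> real k * infdist x F"
          using that by (intro mult_right_mono) (auto simp: infdist_nonneg)
        then show ?thesis using k0 by (simp add: h_def)
      qed
      then have "eventually (\<lambda>k. h k x = 0) sequentially"
        by (auto simp: eventually_sequentially)
      then show ?thesis using x by (simp add: tendsto_eventually)
    qed
    have measure_lim: "(\<lambda>k. integral\<^sup>L L (h k)) \<longlonglongrightarrow> measure L F"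
      if L: "prob_space L" "sets L = sets borel" for L
    proof -
      interpret L: prob_space L by fact
      note L(2)[measurable_cong]
      have [measurable]: "F \<in> sets borel" using F by simp
      have [measurable]: "h k \<in> borel_measurable borel" for k
        using cont by (rule borel_measurable_continuous_onI)
      have "(\<lambda>k. integral\<^sup>L L (h k)) \<longlonglongrightarrow> integral\<^sup>L L (indicator F)"
        using h01 lim by (intro integral_dominated_convergence[where w = "\<lambda>_. 1"]) auto
      then show ?thesis
        using sets_eq_imp_space_eq[OF L(2)] by simp
    qed
    have "(\<lambda>k. integral\<^sup>L M (h k)) = (\<lambda>k. integral\<^sup>L N (h k))"
      using eq[OF cont h01] by (rule ext)
    with measure_lim[OF M] measure_lim[OF N] have "measure M F = measure N F"
      by (metis LIMSEQ_unique)
    then show ?thesis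
      by (simp add: M.emeasure_eq_measure N.emeasure_eq_measure)
  qed simp
  have sigma: "sets (borel :: 'a measure) = sigma_sets UNIV (Collect closed)"
    by (simp add: borel_eq_closed)
  show ?thesis
  proof (rule measure_eqI_generator_eq[where E = "Collect closed" and \<Omega> = UNIV and A = "\<lambda>_. UNIV"])
    show "Int_stable (Collect (closed :: 'a set \<Rightarrow> bool))"
      by (auto simp: Int_stable_def)
  qed (use closed_eq M(2) N(2) sigma in auto)
qed

text \<open>Dominated convergence carries the integrals of bounded continuous functions to the
  limit. This keeps the second marginal of the couplings fixed when passing to the limit.\<close>

lemma distr_eq_of_AE_lim:
  fixes Y :: "nat \<Rightarrow> 'b \<Rightarrow> 'a::metric_space"
  assumes "prob_space \<Omega>" and [measurable]: "\<And>n. Y n \<in> borel_measurable \<Omega>" "Y' \<in> borel_measurable \<Omega>"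
    and lim: "AE \<omega> in \<Omega>. (\<lambda>n. Y n \<omega>) \<longlonglongrightarrow> Y' \<omega>"
    and Q: "\<And>n. distr \<Omega> borel (Y n) = Q"
  shows "distr \<Omega> borel Y' = Q"
proof (rule prob_measure_eqI_continuous)
  interpret prob_space \<Omega> by fact
  show "prob_space (distr \<Omega> borel Y')"
    by (rule prob_space_distr) measurable
  have "prob_space (distr \<Omega> borel (Y 0))"
    by (rule prob_space_distr) measurable
  then show "prob_space Q" by (simp only: Q)
  show "sets Q = sets borel" using Q[of 0] by auto
  fix h :: "'a \<Rightarrow> real"
  assume h: "continuous_on UNIV h" "\<And>x. 0 \<le> h x \<and> h x \<le> 1"
  have [measurable]: "h \<in> borel_measurable borel"
    using h(1) by (rule borel_measurable_continuous_onI)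
  have "(\<lambda>n. \<integral>\<omega>. h (Y n \<omega>) \<partial>\<Omega>) \<longlonglongrightarrow> (\<integral>\<omega>. h (Y' \<omega>) \<partial>\<Omega>)"
  proof (rule integral_dominated_convergence[where w = "\<lambda>_. 1"])
    show "AE \<omega> in \<Omega>. (\<lambda>n. h (Y n \<omega>)) \<longlonglongrightarrow> h (Y' \<omega>)"
      using lim
    proof eventually_elim
      case (elim \<omega>)
      then show ?case
        using continuous_on_tendsto_compose[OF h(1)] by auto
    qed
  qed (use h(2) in auto)
  moreover have "(\<integral>\<omega>. h (Y n \<omega>) \<partial>\<Omega>) = integral\<^sup>L Q h" for n
    unfolding Q[of n, symmetric] by (simp add: integral_distr)
  ultimately have "(\<integral>\<omega>. h (Y' \<omega>) \<partial>\<Omega>) = integral\<^sup>L Q h"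
    by (simp add: LIMSEQ_const_iff)
  then show "integral\<^sup>L (distr \<Omega> borel Y') h = integral\<^sup>L Q h"
    by (simp add: integral_distr)
qed auto

lemma tendsto_componentwise_fun:
  assumes "\<And>i. ((\<lambda>n. f n i) \<longlongrightarrow> g i) F"
  shows "(f \<longlongrightarrow> g) F"
  using assms limitin_componentwise[of "\<lambda>_. euclidean" UNIV f g F]
  by (simp add: euclidean_product_topology)

section \<open>Reverse Fatou lemma for extended-valued integrals\<close>

text \<open>Truncation at level \<open>T\<close>: for \<open>f\<^sup>+\<close>, \<open>(T - f)\<^sup>+\<close>, \<open>f\<^sup>-\<close>, \<open>(f - T)\<^sup>+\<close> no subtraction in \<open>ennreal\<close> occurs.\<close>
lemma nn_integral_truncation:
  assumes "prob_space M" and [measurable]: "f \<in> borel_measurable M" and "0 \<le> T"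
  shows "(\<integral>\<^sup>+ x. ennreal (f x) \<partial>M) + (\<integral>\<^sup>+ x. ennreal (T - f x) \<partial>M)
    = ennreal T + (\<integral>\<^sup>+ x. ennreal (- f x) \<partial>M) + (\<integral>\<^sup>+ x. ennreal (f x - T) \<partial>M)"
proof -
  interpret prob_space M by fact
  have "ennreal (f x) + ennreal (T - f x) = ennreal T + ennreal (- f x) + ennreal (f x - T)" for x
    using \<open>0 \<le> T\<close> by (cases "f x < 0"; cases "f x < T") (auto simp: ennreal_neg simp flip: ennreal_plus)
  then have "(\<integral>\<^sup>+ x. ennreal (f x) + ennreal (T - f x) \<partial>M)
      = (\<integral>\<^sup>+ x. ennreal T + ennreal (- f x) + ennreal (f x - T) \<partial>M)"
    by simp
  then show ?thesis
    by (simp add: nn_integral_add emeasure_space_1)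
qed

text \<open>Fatou's lemma is applied to the positive parts of \<open>T - g n\<close>. The truncation
  identity converts their integrals into \<open>qint\<close>, with an error controlled by the mass
  of \<open>g n\<close> above \<open>T\<close>.\<close>

lemma qint_reverse_Fatou:
  assumes M: "prob_space M" and [measurable]: "\<And>n. g n \<in> borel_measurable M" "g' \<in> borel_measurable M"
    and limsup: "AE x in M. \<forall>t. g' x < t \<longrightarrow> eventually (\<lambda>n. g n x < t) sequentially"
    and ui: "\<And>e. 0 < e \<Longrightarrow> \<exists>T\<ge>0. \<forall>n. (\<integral>\<^sup>+ x. ennreal (g n x - T) \<partial>M) \<le> ennreal e"
    and lim: "(\<lambda>n. qint M (g n)) \<longlonglongrightarrow> S"
  shows "S \<le> qint M g'"
proof (cases "(\<integral>\<^sup>+ x. ennreal (g' x) \<partial>M) = \<infinity>")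
  case True
  then show ?thesis by (simp add: qint_def)
next
  case g'_fin: False
  show ?thesis
  proof (rule ereal_le_epsilon2)
    fix e :: real assume "0 < e"
    then obtain T where "0 \<le> T" and T: "\<And>n. (\<integral>\<^sup>+ x. ennreal (g n x - T) \<partial>M) \<le> ennreal e"
      using ui by blast
    define b where "b n = (\<integral>\<^sup>+ x. ennreal (T - g n x) \<partial>M)" for n
    define b' where "b' = (\<integral>\<^sup>+ x. ennreal (T - g' x) \<partial>M)"
    \<comment> \<open>In the truncation identity the integral of the positive part is finite, so it
      may be subtracted; the excess above \<open>T\<close> costs at most \<open>e\<close>.\<close>
    have upper: "enn2ereal (b n) \<le> ereal (T + e) - qint M (g n)" for n
    proof -
      let ?p = "\<integral>\<^sup>+ x. ennreal (g n x) \<partial>M" and ?m = "\<integral>\<^sup>+ x. ennreal (- g n x) \<partial>M"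
        and ?d = "\<integral>\<^sup>+ x. ennreal (g n x - T) \<partial>M"
      have id: "?p + b n = ennreal T + ?m + ?d"
        unfolding b_def using M \<open>0 \<le> T\<close> by (intro nn_integral_truncation) auto
      have "ennreal (g n x) \<le> ennreal T + ennreal (g n x - T)" for x
        using \<open>0 \<le> T\<close> by (cases "g n x \<le> T") (simp_all add: ennreal_neg ennreal_leI flip: ennreal_plus)
      then have "?p \<le> (\<integral>\<^sup>+ x. ennreal T + ennreal (g n x - T) \<partial>M)"
        by (intro nn_integral_mono)
      also have "\<dots> = ennreal T + ?d"
        using M by (simp add: nn_integral_add prob_space.emeasure_space_1)
      also have "\<dots> < \<infinity>"
        using le_less_trans[OF T ennreal_less_top] by simp
      finally have "?p < \<infinity>" .
      then show ?thesis
        using id T[of n] \<open>0 \<le> T\<close> \<open>0 < e\<close> unfolding qint_def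
        by (cases "?p"; cases "b n"; cases "?m"; cases "?d") (auto simp: top_unique simp flip: ennreal_plus)
    qed
    \<comment> \<open>The same identity for \<open>g'\<close>, with the nonnegative excess above
      \<open>T\<close> dropped.\<close>
    have lower: "ereal T - enn2ereal b' \<le> qint M g'"
    proof -
      let ?p = "\<integral>\<^sup>+ x. ennreal (g' x) \<partial>M" and ?m = "\<integral>\<^sup>+ x. ennreal (- g' x) \<partial>M"
        and ?d = "\<integral>\<^sup>+ x. ennreal (g' x - T) \<partial>M"
      have id: "?p + b' = ennreal T + ?m + ?d"
        unfolding b'_def using M \<open>0 \<le> T\<close> by (intro nn_integral_truncation) auto
      then show ?thesis
        using g'_fin \<open>0 \<le> T\<close> unfolding qint_def
        by (cases "?p"; cases b'; cases "?m"; cases "?d") (auto simp flip: ennreal_plus)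
    qed
    have "b' \<le> (\<integral>\<^sup>+ x. liminf (\<lambda>n. ennreal (T - g n x)) \<partial>M)"
      unfolding b'_def
    proof (rule nn_integral_mono_AE)
      show "AE x in M. ennreal (T - g' x) \<le> liminf (\<lambda>n. ennreal (T - g n x))"
        using limsup
      proof eventually_elim
        case (elim x)
        show ?case
          unfolding le_Liminf_iff
        proof (intro allI impI)
          fix y assume y: "y < ennreal (T - g' x)"
          then obtain r where r: "y = ennreal r" "0 \<le> r" "r < T - g' x"
            by (cases y) (auto simp: ennreal_less_iff)
          then have "eventually (\<lambda>n. g n x < T - r) sequentially"
            using elim by auto
          then show "eventually (\<lambda>n. y < ennreal (T - g n x)) sequentially"
            by eventually_elim (use r in \<open>auto simp: ennreal_less_iff\<close>)
        qed
      qed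
    qed
    also have "\<dots> \<le> liminf b"
      unfolding b_def by (rule nn_integral_liminf) measurable
    also have "\<dots> \<le> liminf (\<lambda>n. e2ennreal (ereal (T + e) - qint M (g n)))"
      by (intro Liminf_mono always_eventually allI)
         (metis upper e2ennreal_enn2ereal e2ennreal_mono)
    also have "\<dots> = e2ennreal (ereal (T + e) - S)"
      by (intro lim_imp_Liminf continuous_on_tendsto_compose[OF continuous_on_e2ennreal[of UNIV]]
          tendsto_diff_ereal_general lim) auto
    finally have "b' \<le> e2ennreal (ereal (T + e) - S)" .
    \<comment> \<open>\<open>e2ennreal\<close> maps negative values to 0, so nonnegativity is needed
      before it can be undone.\<close>
    moreover have "0 \<le> ereal (T + e) - S"
    proof (rule tendsto_lowerbound)
      show "(\<lambda>n. ereal (T + e) - qint M (g n)) \<longlonglongrightarrow> ereal (T + e) - S"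
        by (intro tendsto_diff_ereal_general lim) auto
      show "eventually (\<lambda>n. 0 \<le> ereal (T + e) - qint M (g n)) sequentially"
        by (intro always_eventually allI order_trans[OF _ upper]) auto
    qed auto
    ultimately have "enn2ereal b' \<le> ereal (T + e) - S"
      by (metis enn2ereal_e2ennreal less_eq_ennreal.rep_eq)
    then have "S \<le> ereal T - enn2ereal b' + ereal e"
      by (cases S; cases b') auto
    also have "\<dots> \<le> qint M g' + ereal e"
      using lower by (rule add_right_mono)
    finally show "S \<le> qint M g' + ereal e" .
  qed
qed

section \<open>Sublinear growth of product majorants\<close>

text \<open>One coordinate beyond a threshold \<open>R\<close> already supplies the factor
  \<open>\<eta>\<close>, while the other factors are bounded by \<open>\<delta> r \<le> r\<close>.
  If no coordinate is that large, the product is at most \<open>(1 + R) ^ CARD('n)\<close>.\<close>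

lemma prod_D_class_bound:
  assumes \<delta>: "\<delta> \<in> D_class" and "0 < \<eta>"
  obtains T where "0 \<le> T" "\<And>x :: 'n::finite \<Rightarrow> real. (\<And>k. 0 \<le> x k) \<Longrightarrow>
    (\<Prod>k\<in>UNIV. 1 + \<delta> (x k)) \<le> \<eta> * (\<Prod>k\<in>UNIV. 1 + x k) + T"
proof -
  have \<delta>0: "0 \<le> \<delta> r" "\<delta> r \<le> r" if "0 \<le> r" for r
    using \<delta> that by (auto simp: D_class_def)
  have "((\<lambda>r. \<delta> r / r) \<longlongrightarrow> 0) at_top"
    using \<delta> by (simp add: D_class_def)
  then have "eventually (\<lambda>r. \<bar>\<delta> r / r\<bar> < \<eta> / 2) at_top"
    using tendstoD[of "\<lambda>r. \<delta> r / r" 0 at_top "\<eta> / 2"] \<open>0 < \<eta>\<close> by (simp add: dist_real_def)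
  \<comment> \<open>Beyond \<open>2 / \<eta>\<close> the constant 1 is absorbed by
    \<open>\<eta> / 2 * r\<close>; the bound 1 ensures \<open>r > 0\<close>.\<close>
  moreover have "eventually (\<lambda>r::real. r > max 1 (2 / \<eta>)) at_top"
    by (rule eventually_gt_at_top)
  ultimately have "eventually (\<lambda>r. 1 + \<delta> r \<le> \<eta> * (1 + r)) at_top"
  proof eventually_elim
    case (elim r)
    then have "r > 0" "2 / \<eta> < r" by auto
    then have "\<delta> r < \<eta> / 2 * r"
      using elim by (simp add: abs_less_iff pos_divide_less_eq)
    moreover have "1 < \<eta> / 2 * r"
      using \<open>2 / \<eta> < r\<close> \<open>0 < \<eta>\<close> by (simp add: field_simps)
    ultimately show ?case
      using \<open>0 < \<eta>\<close> by (simp add: algebra_simps)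
  qed
  then obtain R0 where R0: "\<And>r. r \<ge> R0 \<Longrightarrow> 1 + \<delta> r \<le> \<eta> * (1 + r)"
    by (auto simp: eventually_at_top_linorder)
  define R where "R = max 0 R0"
  show thesis
  proof
    show "0 \<le> (1 + R) ^ CARD('n)"
      by (simp add: R_def)
    fix x :: "'n \<Rightarrow> real" assume x: "\<And>k. 0 \<le> x k"
    have pos: "0 \<le> (\<Prod>k\<in>UNIV. 1 + x k)"
      using x by (intro prod_nonneg) (simp add: add_nonneg_nonneg)
    show "(\<Prod>k\<in>UNIV. 1 + \<delta> (x k)) \<le> \<eta> * (\<Prod>k\<in>UNIV. 1 + x k) + (1 + R) ^ CARD('n)"
    proof (cases "\<exists>j. R < x j")
      case True
      then obtain j where j: "R < x j" ..
      have "(\<Prod>k\<in>UNIV. 1 + \<delta> (x k)) = (1 + \<delta> (x j)) * (\<Prod>k\<in>UNIV - {j}. 1 + \<delta> (x k))"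
        by (rule prod.remove) auto
      also have "\<dots> \<le> (\<eta> * (1 + x j)) * (\<Prod>k\<in>UNIV - {j}. 1 + x k)"
        using x \<delta>0 R0[of "x j"] j \<open>0 < \<eta>\<close>
        by (intro mult_mono prod_mono prod_nonneg) (auto simp: R_def add_nonneg_nonneg)
      also have "\<dots> = \<eta> * (\<Prod>k\<in>UNIV. 1 + x k)"
        using prod.remove[of UNIV j "\<lambda>k. 1 + x k"] by simp
      finally show ?thesis
        by (simp add: R_def add_increasing2)
    next
      case False
      then have "(\<Prod>k\<in>UNIV. 1 + \<delta> (x k)) \<le> (\<Prod>k\<in>(UNIV::'n set). 1 + R)"
        using x \<delta>0 by (intro prod_mono) (auto simp: not_less add_nonneg_nonneg intro: order_trans[OF \<delta>0(2)])
      then show ?thesis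
        using pos \<open>0 < \<eta>\<close> by (simp add: add_increasing)
    qed
  qed
qed

section \<open>Wasserstein balls\<close>

lemma lsc_cost_measurable:
  fixes c :: "'a::topological_space \<Rightarrow> 'a \<Rightarrow> real"
  assumes "lsc_cost c"
  shows "(\<lambda>z. c (fst z) (snd z)) \<in> borel_measurable borel"
  using assms unfolding lsc_cost_def
  by (intro borel_measurable_iff_le[THEN iffD2]) (auto intro: borel_closed)

lemma lsc_cost_measurable_section:
  fixes c :: "'a::topological_space \<Rightarrow> 'a \<Rightarrow> real"
  assumes "lsc_cost c"
  shows "c x \<in> borel_measurable borel"
proof -
  have "(\<lambda>y. (x, y)) \<in> borel \<rightarrow>\<^sub>M borel"
    by (intro borel_measurable_continuous_onI continuous_intros)
  from measurable_comp[OF this lsc_cost_measurable[OF assms]] show ?thesis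
    by (simp add: comp_def)
qed

lemma lsc_cost_le_liminf:
  assumes "lsc_cost c" "u \<longlonglongrightarrow> x" "v \<longlonglongrightarrow> y"
  shows "ennreal (c x y) \<le> liminf (\<lambda>n. ennreal (c (u n) (v n)))"
  unfolding le_Liminf_iff
proof (intro allI impI)
  fix a assume "a < ennreal (c x y)"
  then obtain r where r: "a = ennreal r" "0 \<le> r" "r < c x y"
    by (cases a) (auto simp: ennreal_less_iff)
  have "open (- {z. c (fst z) (snd z) \<le> r})"
    using assms(1) by (auto simp: lsc_cost_def open_Compl)
  moreover have "(\<lambda>n. (u n, v n)) \<longlonglongrightarrow> (x, y)"
    using assms by (intro tendsto_Pair)
  ultimately have "eventually (\<lambda>n. (u n, v n) \<in> - {z. c (fst z) (snd z) \<le> r}) sequentially"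
    using r by (intro topological_tendstoD) auto
  then show "eventually (\<lambda>n. a < ennreal (c (u n) (v n))) sequentially"
    by eventually_elim (use r in \<open>auto simp: ennreal_less_iff\<close>)
qed

lemma usc_eventually_less:
  assumes "usc f" "u \<longlonglongrightarrow> x" "f x < t"
  shows "eventually (\<lambda>n. f (u n) < t) sequentially"
proof -
  have "open (- {x. t \<le> f x})"
    using assms(1) by (auto simp: usc_def open_Compl)
  then have "eventually (\<lambda>n. u n \<in> - {x. t \<le> f x}) sequentially"
    using assms(2,3) by (intro topological_tendstoD) auto
  then show ?thesis
    by eventually_elim auto
qed

text \<open>The weak triangle inequality with intermediate point \<open>snd z\<close> is integrated
  against \<open>\<pi>\<close>. It serves both the uniform bound over the ball and the limit
  measure.\<close>

lemma coupling_moment_bound: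
  assumes c: "transport_cost c" and "0 < K" and tri: "\<And>x y z. c x y \<le> K * (c x z + c z y)"
    and \<pi>: "\<pi> \<in> couplings P Q"
  shows "(\<integral>\<^sup>+ x. ennreal (c x0 x) \<partial>P) \<le>
    ennreal K * ((\<integral>\<^sup>+ x. ennreal (c x0 x) \<partial>Q) + (\<integral>\<^sup>+ z. ennreal (c (fst z) (snd z)) \<partial>\<pi>))"
proof -
  have lsc: "lsc_cost c" and nonneg: "\<And>x y. 0 \<le> c x y" and sym: "\<And>x y. c x y = c y x"
    using c by (auto simp: transport_cost_def)
  note [measurable] = lsc_cost_measurable[OF lsc] lsc_cost_measurable_section[OF lsc]
  have [measurable_cong]: "sets \<pi> = sets borel"
    and P: "P = distr \<pi> borel fst" and Q: "Q = distr \<pi> borel snd"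
    using \<pi> by (auto simp: couplings_def)
  have [measurable]: "fst \<in> borel_measurable \<pi>" "snd \<in> borel_measurable \<pi>"
    by (auto intro!: borel_measurable_continuous_onI continuous_intros
        simp: measurable_cong_sets[OF \<open>sets \<pi> = sets borel\<close> refl])
  have "(\<integral>\<^sup>+ x. ennreal (c x0 x) \<partial>P) = (\<integral>\<^sup>+ z. ennreal (c x0 (fst z)) \<partial>\<pi>)"
    unfolding P by (rule nn_integral_distr) measurable
  also have "\<dots> \<le> (\<integral>\<^sup>+ z. ennreal K * (ennreal (c x0 (snd z)) + ennreal (c (fst z) (snd z))) \<partial>\<pi>)"
  proof (rule nn_integral_mono)
    fix z :: "'a \<times> 'a"
    have "c x0 (fst z) \<le> K * (c x0 (snd z) + c (fst z) (snd z))"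
      using tri[of x0 "fst z" "snd z"] sym[of "fst z" "snd z"] by simp
    then show "ennreal (c x0 (fst z)) \<le> ennreal K * (ennreal (c x0 (snd z)) + ennreal (c (fst z) (snd z)))"
      using nonneg \<open>0 < K\<close> by (simp add: ennreal_leI flip: ennreal_plus ennreal_mult)
  qed
  also have "\<dots> = ennreal K * ((\<integral>\<^sup>+ z. ennreal (c x0 (snd z)) \<partial>\<pi>) + (\<integral>\<^sup>+ z. ennreal (c (fst z) (snd z)) \<partial>\<pi>))"
    by (simp add: nn_integral_cmult nn_integral_add)
  also have "(\<integral>\<^sup>+ z. ennreal (c x0 (snd z)) \<partial>\<pi>) = (\<integral>\<^sup>+ x. ennreal (c x0 x) \<partial>Q)"
    unfolding Q by (rule nn_integral_distr[symmetric]) measurable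
  finally show ?thesis .
qed

text \<open>No attainment of the infimum in \<open>W_cost\<close> is assumed; the slack
  \<open>e\<close> buys an actual coupling.\<close>

lemma W_ball_coupling:
  assumes "P \<in> W_ball c \<rho> Q" "0 < \<rho>" "0 < e"
  obtains \<pi> where "\<pi> \<in> couplings P Q" "(\<integral>\<^sup>+ z. ennreal (c (fst z) (snd z)) \<partial>\<pi>) \<le> ennreal (\<rho> + e)"
proof -
  have "W_cost c P Q < ennreal (\<rho> + e)"
    using assms by (auto simp: W_ball_def ennreal_less_iff intro: le_less_trans)
  then show thesis
    unfolding W_cost_def INF_less_iff using that by (auto intro: less_imp_le)
qed

text \<open>The diagonal coupling has cost 0. This makes the ball nonempty, so that a maximizing
  sequence exists.\<close>

lemma W_ball_self:
  assumes c: "transport_cost c" and Q: "Q \<in> P_c c"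
  shows "Q \<in> W_ball c \<rho> (Q :: 'a::{second_countable_topology} measure)"
proof -
  have lsc: "lsc_cost c" and zero: "\<And>x. c x x = 0"
    using c by (auto simp: transport_cost_def)
  note [measurable] = lsc_cost_measurable[OF lsc]
  have "prob_space Q" and Qs: "sets Q = sets borel"
    using Q by (auto simp: P_c_def prob_borel_def)
  interpret prob_space Q by fact
  note Qs[measurable_cong]
  define \<pi> where "\<pi> = distr Q borel (\<lambda>x. (x, x))"
  have [measurable]: "(\<lambda>x::'a. (x, x)) \<in> borel \<rightarrow>\<^sub>M borel"
    "fst \<in> borel \<rightarrow>\<^sub>M (borel :: 'a measure)" "snd \<in> borel \<rightarrow>\<^sub>M (borel :: 'a measure)"
    by (intro borel_measurable_continuous_onI continuous_intros)+
  have "\<pi> \<in> couplings Q Q"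
    unfolding couplings_def \<pi>_def
    by (auto intro!: prob_space_distr distr_id2 simp: distr_distr comp_def Qs)
  moreover have "(\<integral>\<^sup>+ z. ennreal (c (fst z) (snd z)) \<partial>\<pi>) = 0"
    unfolding \<pi>_def by (subst nn_integral_distr) (simp_all add: zero)
  ultimately have "W_cost c Q Q \<le> 0"
    unfolding W_cost_def by (intro INF_lower2[of \<pi>]) simp_all
  then show ?thesis
    using Q by (simp add: W_ball_def)
qed

text \<open>Membership in \<open>P_c\<close> gives a finite moment at some base point
  \<open>x1\<close>; the weak triangle inequality moves it to the prescribed \<open>x0\<close>, and
  couplings carry it from \<open>Q\<close> to all of the ball.\<close>

lemma W_ball_moment_bound:
  assumes c: "transport_cost c" and "weak_triangle c" and Q: "Q \<in> P_c c" and "0 < \<rho>"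
  obtains R where "0 \<le> R" "\<And>P. P \<in> W_ball c \<rho> Q \<Longrightarrow> (\<integral>\<^sup>+ x. ennreal (c x0 x) \<partial>P) \<le> ennreal R"
proof -
  have lsc: "lsc_cost c" and nonneg: "\<And>x y. 0 \<le> c x y"
    using c by (auto simp: transport_cost_def)
  obtain K where "0 < K" and tri: "\<And>x y z. c x y \<le> K * (c x z + c z y)"
    using \<open>weak_triangle c\<close> by (auto simp: weak_triangle_def)
  obtain x1 where x1: "(\<integral>\<^sup>+ x. ennreal (c x1 x) \<partial>Q) < \<infinity>" and "prob_space Q" and Qs: "sets Q = sets borel"
    using Q by (auto simp: P_c_def prob_borel_def)
  interpret prob_space Q by fact
  note Qs[measurable_cong] and [measurable] = lsc_cost_measurable_section[OF lsc]
  have "(\<integral>\<^sup>+ x. ennreal (c x0 x) \<partial>Q) \<le> (\<integral>\<^sup>+ x. ennreal K * (ennreal (c x0 x1) + ennreal (c x1 x)) \<partial>Q)"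
    using nonneg \<open>0 < K\<close> tri[of x0 _ x1]
    by (intro nn_integral_mono) (simp add: ennreal_leI flip: ennreal_plus ennreal_mult)
  also have "\<dots> = ennreal K * (ennreal (c x0 x1) + (\<integral>\<^sup>+ x. ennreal (c x1 x) \<partial>Q))"
    by (simp add: nn_integral_cmult nn_integral_add emeasure_space_1)
  also have "\<dots> < \<infinity>"
    using x1 by (simp add: ennreal_mult_less_top)
  finally obtain A where A: "0 \<le> A" "(\<integral>\<^sup>+ x. ennreal (c x0 x) \<partial>Q) = ennreal A"
    by (cases "\<integral>\<^sup>+ x. ennreal (c x0 x) \<partial>Q") auto
  show thesis
  proof
    \<comment> \<open>\<open>A\<close> is the moment of \<open>Q\<close> at \<open>x0\<close>, and
      \<open>\<rho> + 1\<close> bounds the cost of a coupling chosen with slack 1.\<close>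
    show "0 \<le> K * (A + (\<rho> + 1))"
      using A \<open>0 < K\<close> \<open>0 < \<rho>\<close> by simp
    fix P assume "P \<in> W_ball c \<rho> Q"
    then obtain \<pi> where \<pi>: "\<pi> \<in> couplings P Q"
        "(\<integral>\<^sup>+ z. ennreal (c (fst z) (snd z)) \<partial>\<pi>) \<le> ennreal (\<rho> + 1)"
      using W_ball_coupling[of P c \<rho> Q 1] \<open>0 < \<rho>\<close> by auto
    have "(\<integral>\<^sup>+ x. ennreal (c x0 x) \<partial>P) \<le> ennreal K * (ennreal A + (\<integral>\<^sup>+ z. ennreal (c (fst z) (snd z)) \<partial>\<pi>))"
      using coupling_moment_bound[OF c \<open>0 < K\<close> tri \<pi>(1), of x0] unfolding A(2) .
    also have "\<dots> \<le> ennreal K * (ennreal A + ennreal (\<rho> + 1))"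
      using \<pi>(2) by (intro mult_left_mono add_left_mono) auto
    also have "\<dots> = ennreal (K * (A + (\<rho> + 1)))"
      using A \<open>0 < K\<close> \<open>0 < \<rho>\<close> by (simp add: ennreal_mult flip: ennreal_plus)
    finally show "(\<integral>\<^sup>+ x. ennreal (c x0 x) \<partial>P) \<le> ennreal (K * (A + (\<rho> + 1)))" .
  qed
qed

section \<open>Integrals over finite powers of a measure\<close>

text \<open>Independence of the coordinates factorizes the integral, and each factor is at most
  \<open>1 + R\<close>.\<close>

lemma nn_integral_PiM_prod_le:
  fixes f :: "'b \<Rightarrow> real"
  assumes "prob_space M" and [measurable]: "f \<in> borel_measurable M" and f: "\<And>x. 0 \<le> f x"
    and R: "0 \<le> R" "(\<integral>\<^sup>+ x. ennreal (f x) \<partial>M) \<le> ennreal R"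
  shows "(\<integral>\<^sup>+ \<omega>. ennreal (\<Prod>k\<in>UNIV. 1 + f (\<omega> k)) \<partial>(Pi\<^sub>M UNIV (\<lambda>_::'n::finite. M)))
    \<le> ennreal ((1 + R) ^ CARD('n))"
proof -
  interpret prob_space M by fact
  interpret product_sigma_finite "\<lambda>_::'n. M" ..
  have "(\<integral>\<^sup>+ \<omega>. ennreal (\<Prod>k\<in>UNIV. 1 + f (\<omega> k)) \<partial>(Pi\<^sub>M UNIV (\<lambda>_::'n. M)))
      = (\<integral>\<^sup>+ \<omega>. (\<Prod>k\<in>UNIV. ennreal (1 + f (\<omega> k))) \<partial>(Pi\<^sub>M UNIV (\<lambda>_::'n. M)))"
    by (subst prod_ennreal) (simp_all add: f add_nonneg_nonneg del: ennreal_plus)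
  also have "\<dots> = (\<Prod>k\<in>(UNIV::'n set). \<integral>\<^sup>+ x. ennreal (1 + f x) \<partial>M)"
    by (rule product_nn_integral_prod) auto
  also have "\<dots> = (1 + (\<integral>\<^sup>+ x. ennreal (f x) \<partial>M)) ^ CARD('n)"
    using f by (simp add: nn_integral_add emeasure_space_1)
  also have "\<dots> \<le> (1 + ennreal R) ^ CARD('n)"
    using R by (intro power_mono add_left_mono) auto
  also have "\<dots> = ennreal ((1 + R) ^ CARD('n))"
    using R by (simp add: flip: ennreal_power)
  finally show ?thesis .
qed

lemma borel_measurable_PiM_UNIV:
  fixes l :: "('n::finite \<Rightarrow> 'a::second_countable_topology) \<Rightarrow> real"
  assumes "l \<in> borel_measurable borel" "sets P = sets borel"
  shows "l \<in> borel_measurable (Pi\<^sub>M UNIV (\<lambda>_::'n. P))"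
proof -
  have "sets (Pi\<^sub>M UNIV (\<lambda>_::'n. P)) = sets (Pi\<^sub>M UNIV (\<lambda>_::'n. borel :: 'a measure))"
    using assms by (intro sets_PiM_cong) auto
  also have "\<dots> = sets borel"
    by (rule sets_PiM_equal_borel)
  finally show ?thesis
    using assms(1) measurable_cong_sets[OF _ refl] by blast
qed

text \<open>The power of an image measure is the image of the power under the coordinatewise map.
  All integrals thereby move to one fixed space, where convergence theorems apply.\<close>

lemma qint_PiM_distr:
  fixes l :: "('n::finite \<Rightarrow> 'a::second_countable_topology) \<Rightarrow> real"
  assumes \<Omega>: "prob_space \<Omega>" and X: "X \<in> borel_measurable \<Omega>" and l: "l \<in> borel_measurable borel"
  shows "qint (Pi\<^sub>M UNIV (\<lambda>_::'n. distr \<Omega> borel X)) l = qint (Pi\<^sub>M UNIV (\<lambda>_::'n. \<Omega>)) (\<lambda>\<omega>. l (\<lambda>i. X (\<omega> i)))"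
    and "(\<lambda>\<omega>. l (\<lambda>i. X (\<omega> i))) \<in> borel_measurable (Pi\<^sub>M UNIV (\<lambda>_::'n. \<Omega>))"
proof -
  define P where "P = distr \<Omega> borel X"
  have P: "prob_space P" "sets P = sets borel"
    unfolding P_def using \<Omega> X by (auto intro: prob_space.prob_space_distr)
  have X'[measurable]: "X \<in> \<Omega> \<rightarrow>\<^sub>M P"
    using X by (simp add: measurable_cong_sets[OF refl P(2)])
  have compose: "compose UNIV X = (\<lambda>\<omega> i::'n. X (\<omega> i))"
    by (simp add: compose_def fun_eq_iff)
  have "distr (Pi\<^sub>M UNIV (\<lambda>_::'n. \<Omega>)) (Pi\<^sub>M UNIV (\<lambda>_. P)) (compose UNIV X) = Pi\<^sub>M UNIV (\<lambda>_::'n. distr \<Omega> P X)"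
    by (rule distr_PiM_finite_prob_space') (use \<Omega> P in auto)
  moreover have "distr \<Omega> P X = P"
    unfolding P_def by (rule distr_cong) auto
  ultimately have PiM: "Pi\<^sub>M UNIV (\<lambda>_::'n. P) = distr (Pi\<^sub>M UNIV (\<lambda>_::'n. \<Omega>)) (Pi\<^sub>M UNIV (\<lambda>_. P)) (\<lambda>\<omega> i. X (\<omega> i))"
    by (simp add: compose)
  have meas[measurable]: "(\<lambda>\<omega> i. X (\<omega> i)) \<in> Pi\<^sub>M UNIV (\<lambda>_::'n. \<Omega>) \<rightarrow>\<^sub>M Pi\<^sub>M UNIV (\<lambda>_::'n. P)"
    by (rule measurable_PiM_single') (auto simp: space_PiM intro: measurable_space[OF X'])
  have [measurable]: "l \<in> borel_measurable (Pi\<^sub>M UNIV (\<lambda>_::'n. P))"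
    using l P(2) by (rule borel_measurable_PiM_UNIV)
  show "(\<lambda>\<omega>. l (\<lambda>i. X (\<omega> i))) \<in> borel_measurable (Pi\<^sub>M UNIV (\<lambda>_::'n. \<Omega>))"
    by measurable
  have "(\<integral>\<^sup>+ x. ennreal (h (l x)) \<partial>Pi\<^sub>M UNIV (\<lambda>_::'n. P)) = (\<integral>\<^sup>+ \<omega>. ennreal (h (l (\<lambda>i. X (\<omega> i)))) \<partial>Pi\<^sub>M UNIV (\<lambda>_::'n. \<Omega>))"
    if [measurable]: "h \<in> borel_measurable borel" for h :: "real \<Rightarrow> real"
    by (subst PiM, subst nn_integral_distr) measurable
  from this[of "\<lambda>x. x"] this[of uminus]
  show "qint (Pi\<^sub>M UNIV (\<lambda>_::'n. distr \<Omega> borel X)) l = qint (Pi\<^sub>M UNIV (\<lambda>_::'n. \<Omega>)) (\<lambda>\<omega>. l (\<lambda>i. X (\<omega> i)))"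
    by (simp add: qint_def P_def)
qed

lemma prob_cost_gt_le:
  assumes "prob_space P" "sets P = sets borel" "lsc_cost c" "\<And>x y. 0 \<le> c x y"
    and R: "0 \<le> R" "(\<integral>\<^sup>+ x. ennreal (c x0 x) \<partial>P) \<le> ennreal R" and "0 < m"
  shows "measure P {x. m < c x0 x} \<le> R / m"
proof -
  interpret prob_space P by fact
  note \<open>sets P = sets borel\<close>[measurable_cong] and [measurable] = lsc_cost_measurable_section[OF \<open>lsc_cost c\<close>]
  have space: "space P = UNIV"
    using sets_eq_imp_space_eq[OF assms(2)] by simp
  have "emeasure P {x. m < c x0 x} \<le> emeasure P {x\<in>space P. 1 \<le> ennreal (1 / m) * ennreal (c x0 x)}"
    using \<open>0 < m\<close> assms(4)
    by (intro emeasure_mono) (auto simp: space divide_simps simp flip: ennreal_mult')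
  also have "\<dots> \<le> ennreal (1 / m) * (\<integral>\<^sup>+ x. ennreal (c x0 x) * indicator (space P) x \<partial>P)"
    by (rule nn_integral_Markov_inequality) auto
  also have "\<dots> = ennreal (1 / m) * (\<integral>\<^sup>+ x. ennreal (c x0 x) \<partial>P)"
    by (simp add: space)
  also have "\<dots> \<le> ennreal (1 / m) * ennreal R"
    using R by (intro mult_left_mono) auto
  also have "\<dots> = ennreal (R / m)"
    using \<open>0 < m\<close> R by (simp flip: ennreal_mult')
  finally show ?thesis
    using R \<open>0 < m\<close> by (simp add: emeasure_eq_measure)
qed

section \<open>Finiteness and attainment\<close>

lemma S_val_finite:
  fixes c :: "'a::polish_space \<Rightarrow> 'a \<Rightarrow> real" and l :: "('n::finite \<Rightarrow> 'a) \<Rightarrow> real"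
  assumes c: "transport_cost c" and "weak_triangle c" and Q: "Q \<in> P_c c" and "0 < \<rho>"
    and l: "l \<in> borel_measurable borel" "l \<in> G_hat c"
  shows "S_val c \<rho> Q l < \<infinity>"
proof -
  have lsc: "lsc_cost c" and nonneg: "\<And>x y. 0 \<le> c x y"
    using c by (auto simp: transport_cost_def)
  obtain C x0 where "0 < C" and C: "\<And>x. l x \<le> C * (\<Prod>k\<in>UNIV. 1 + c x0 (x k))"
    using l(2) by (auto simp: G_hat_def)
  obtain R where "0 \<le> R" and R: "\<And>P. P \<in> W_ball c \<rho> Q \<Longrightarrow> (\<integral>\<^sup>+ x. ennreal (c x0 x) \<partial>P) \<le> ennreal R"
    using W_ball_moment_bound[OF c \<open>weak_triangle c\<close> Q \<open>0 < \<rho>\<close>] by metis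
  have "qint (Pi\<^sub>M UNIV (\<lambda>_::'n. P)) l \<le> ereal (C * (1 + R) ^ CARD('n))" if "P \<in> W_ball c \<rho> Q" for P
  proof -
    have "prob_space P" and Ps: "sets P = sets borel"
      using that by (auto simp: W_ball_def P_c_def prob_borel_def)
    note Ps[measurable_cong] and [measurable] = lsc_cost_measurable_section[OF lsc]
    have "(\<integral>\<^sup>+ x. ennreal (l x) \<partial>Pi\<^sub>M UNIV (\<lambda>_::'n. P))
        \<le> (\<integral>\<^sup>+ x. ennreal C * ennreal (\<Prod>k\<in>UNIV. 1 + c x0 (x k)) \<partial>Pi\<^sub>M UNIV (\<lambda>_::'n. P))"
      using C \<open>0 < C\<close> by (intro nn_integral_mono) (simp add: ennreal_leI flip: ennreal_mult')
    also have "\<dots> = ennreal C * (\<integral>\<^sup>+ x. ennreal (\<Prod>k\<in>UNIV. 1 + c x0 (x k)) \<partial>Pi\<^sub>M UNIV (\<lambda>_::'n. P))"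
      by (rule nn_integral_cmult) measurable
    also have "\<dots> \<le> ennreal C * ennreal ((1 + R) ^ CARD('n))"
      using nonneg by (intro mult_left_mono nn_integral_PiM_prod_le \<open>prob_space P\<close> \<open>0 \<le> R\<close> R that) auto
    also have "\<dots> = ennreal (C * (1 + R) ^ CARD('n))"
      using \<open>0 < C\<close> by (simp flip: ennreal_mult')
    finally have "enn2ereal (\<integral>\<^sup>+ x. ennreal (l x) \<partial>Pi\<^sub>M UNIV (\<lambda>_::'n. P)) \<le> ereal (C * (1 + R) ^ CARD('n))"
      using \<open>0 < C\<close> \<open>0 \<le> R\<close> by (simp add: less_eq_ennreal.rep_eq)
    \<comment> \<open>The negative part can only lower \<open>qint\<close>.\<close>
    then show ?thesis
      unfolding qint_def by (intro order_trans[OF ereal_diff_le_self]) auto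
  qed
  then have "S_val c \<rho> Q l \<le> ereal (C * (1 + R) ^ CARD('n))"
    unfolding S_val_def by (rule SUP_least)
  then show ?thesis
    by (rule le_less_trans) simp
qed

text \<open>Markov's inequality makes the sublevel set carry most of each marginal, and a union
  bound passes this to its compact square.\<close>

lemma tight_couplings:
  fixes c :: "'a::polish_space \<Rightarrow> 'a \<Rightarrow> real"
  assumes c: "transport_cost c" and comp: "\<And>r. compact {x. c x0 x \<le> r}" and "0 \<le> R"
    and \<pi>: "\<And>n. \<pi> n \<in> couplings (P n) (Q n)"
    and P: "\<And>n. (\<integral>\<^sup>+ x. ennreal (c x0 x) \<partial>P n) \<le> ennreal R"
    and Q: "\<And>n. (\<integral>\<^sup>+ x. ennreal (c x0 x) \<partial>Q n) \<le> ennreal R"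
    and "0 < e"
  shows "\<exists>K. compact K \<and> (\<forall>n. measure (\<pi> n) (- K) < e)"
proof -
  have lsc: "lsc_cost c" and nonneg: "\<And>x y. 0 \<le> c x y"
    using c by (auto simp: transport_cost_def)
  note [measurable] = lsc_cost_measurable_section[OF lsc]
  \<comment> \<open>Chosen so that two Markov bounds \<open>R / m\<close> sum to less than
    \<open>e\<close>; the added 1 makes this strict and keeps \<open>m\<close> positive for
    \<open>R = 0\<close>.\<close>
  define m where "m = 2 * R / e + 1"
  have "0 < m"
    using \<open>0 \<le> R\<close> \<open>0 < e\<close> by (simp add: m_def add_nonneg_pos)
  have "2 * R < e * m"
    using \<open>0 < e\<close> by (simp add: m_def field_simps)
  then have m: "R / m + R / m < e"
    using \<open>0 < m\<close> by (simp add: field_simps)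
  define K where "K = {x. c x0 x \<le> m}"
  have "measure (\<pi> n) (- (K \<times> K)) < e" for n
  proof -
    have "prob_space (\<pi> n)" and \<pi>s: "sets (\<pi> n) = sets borel"
      and P_eq: "P n = distr (\<pi> n) borel fst" and Q_eq: "Q n = distr (\<pi> n) borel snd"
      using \<pi>[of n] by (auto simp: couplings_def)
    interpret prob_space "\<pi> n" by fact
    have space: "space (\<pi> n) = UNIV"
      using sets_eq_imp_space_eq[OF \<pi>s] by simp
    have [measurable]: "fst \<in> borel_measurable (\<pi> n)" "snd \<in> borel_measurable (\<pi> n)"
      by (auto intro!: borel_measurable_continuous_onI continuous_intros
          simp: measurable_cong_sets[OF \<pi>s refl])
    have A[measurable]: "{x. m < c x0 x} \<in> sets borel"
      by measurable
    have "measure (\<pi> n) (- (K \<times> K)) \<le> measure (\<pi> n) (fst -` {x. m < c x0 x} \<inter> space (\<pi> n)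
        \<union> snd -` {x. m < c x0 x} \<inter> space (\<pi> n))"
    proof (rule finite_measure_mono)
      show "fst -` {x. m < c x0 x} \<inter> space (\<pi> n) \<union> snd -` {x. m < c x0 x} \<inter> space (\<pi> n) \<in> sets (\<pi> n)"
        by (intro sets.Un measurable_sets[OF _ A]) measurable
    qed (auto simp: K_def space)
    also have "\<dots> \<le> measure (\<pi> n) (fst -` {x. m < c x0 x} \<inter> space (\<pi> n))
        + measure (\<pi> n) (snd -` {x. m < c x0 x} \<inter> space (\<pi> n))"
      by (rule measure_Un_le) measurable
    also have "measure (\<pi> n) (fst -` {x. m < c x0 x} \<inter> space (\<pi> n)) = measure (P n) {x. m < c x0 x}"
      unfolding P_eq by (rule measure_distr[symmetric]) measurable
    also have "measure (\<pi> n) (snd -` {x. m < c x0 x} \<inter> space (\<pi> n)) = measure (Q n) {x. m < c x0 x}"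
      unfolding Q_eq by (rule measure_distr[symmetric]) measurable
    also have "measure (P n) {x. m < c x0 x} \<le> R / m"
      using P_eq by (intro prob_cost_gt_le lsc nonneg P \<open>0 \<le> R\<close> \<open>0 < m\<close>) (auto intro: prob_space_distr)
    also have "measure (Q n) {x. m < c x0 x} \<le> R / m"
      using Q_eq by (intro prob_cost_gt_le lsc nonneg Q \<open>0 \<le> R\<close> \<open>0 < m\<close>) (auto intro: prob_space_distr)
    finally show ?thesis
      using m by linarith
  qed
  moreover have "compact (K \<times> K)"
    unfolding K_def using comp by (intro compact_Times)
  ultimately show ?thesis by blast
qed

lemma S_val_attained:
  fixes c :: "'a::polish_space \<Rightarrow> 'a \<Rightarrow> real" and l :: "('n::finite \<Rightarrow> 'a) \<Rightarrow> real"
  assumes c: "transport_cost c" and proper: "proper_cost c" and Q: "Q \<in> P_c c" and "0 < \<rho>"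
    and l: "l \<in> borel_measurable borel" "usc l" "l \<in> G_hat_lt c"
  shows "\<exists>P\<in>W_ball c \<rho> Q. qint (Pi\<^sub>M UNIV (\<lambda>_::'n. P)) l = S_val c \<rho> Q l"
proof -
  have lsc: "lsc_cost c" and nonneg: "\<And>x y. 0 \<le> c x y"
    using c by (auto simp: transport_cost_def)
  have "weak_triangle c" and comp: "\<And>x r. compact {y. c x y \<le> r}"
    using proper by (auto simp: proper_cost_def)
  note [measurable] = lsc_cost_measurable[OF lsc] lsc_cost_measurable_section[OF lsc]
  have [measurable]: "fst \<in> borel \<rightarrow>\<^sub>M (borel :: 'a measure)" "snd \<in> borel \<rightarrow>\<^sub>M (borel :: 'a measure)"
    by (intro borel_measurable_continuous_onI continuous_intros)+
  obtain C \<delta> x0 where "0 < C" "\<delta> \<in> D_class" and C: "\<And>x. l x \<le> C * (\<Prod>k\<in>UNIV. 1 + \<delta> (c x0 (x k)))"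
    using l(3) by (auto simp: G_hat_lt_def)
  obtain R where "0 \<le> R" and R: "\<And>P. P \<in> W_ball c \<rho> Q \<Longrightarrow> (\<integral>\<^sup>+ x. ennreal (c x0 x) \<partial>P) \<le> ennreal R"
    using W_ball_moment_bound[OF c \<open>weak_triangle c\<close> Q \<open>0 < \<rho>\<close>] by metis
  have Q_ball: "Q \<in> W_ball c \<rho> Q"
    using c Q by (rule W_ball_self)
  let ?J = "\<lambda>P. qint (Pi\<^sub>M UNIV (\<lambda>_::'n. P)) l"
  have "?J ` W_ball c \<rho> Q \<noteq> {}"
    using Q_ball by blast
  from Sup_countable_SUP[OF this] obtain f :: "nat \<Rightarrow> ereal" where f: "incseq f"
      "range f \<subseteq> ?J ` W_ball c \<rho> Q" "S_val c \<rho> Q l = (SUP i. f i)"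
    unfolding S_val_def by blast
  have "\<forall>n. \<exists>P. P \<in> W_ball c \<rho> Q \<and> f n = ?J P"
    using f(2) by blast
  then obtain P where P: "\<And>n. P n \<in> W_ball c \<rho> Q" "\<And>n. f n = ?J (P n)"
    by metis
  have lim_J: "(\<lambda>n. ?J (P n)) \<longlonglongrightarrow> S_val c \<rho> Q l"
    using LIMSEQ_SUP[OF f(1)] by (simp add: f(3) flip: P(2))
  \<comment> \<open>The slack tends to 0, so that the limiting coupling costs at most
    \<open>\<rho>\<close>.\<close>
  have "\<forall>n. \<exists>\<pi>. \<pi> \<in> couplings (P n) Q \<and>
      (\<integral>\<^sup>+ z. ennreal (c (fst z) (snd z)) \<partial>\<pi>) \<le> ennreal (\<rho> + inverse (real (Suc n)))"
  proof
    fix n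
    have "0 < inverse (real (Suc n))" by simp
    with P(1) \<open>0 < \<rho>\<close> show "\<exists>\<pi>. \<pi> \<in> couplings (P n) Q \<and>
        (\<integral>\<^sup>+ z. ennreal (c (fst z) (snd z)) \<partial>\<pi>) \<le> ennreal (\<rho> + inverse (real (Suc n)))"
      by (rule W_ball_coupling) blast
  qed
  then obtain \<pi> where \<pi>: "\<And>n. \<pi> n \<in> couplings (P n) Q"
      "\<And>n. (\<integral>\<^sup>+ z. ennreal (c (fst z) (snd z)) \<partial>\<pi> n) \<le> ennreal (\<rho> + inverse (real (Suc n)))"
    by metis
  have \<pi>_prob: "prob_space (\<pi> n)" and \<pi>_sets: "sets (\<pi> n) = sets borel"
    and \<pi>_fst: "distr (\<pi> n) borel fst = P n" and \<pi>_snd: "distr (\<pi> n) borel snd = Q" for n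
    using \<pi>(1)[of n] by (auto simp: couplings_def)
  \<comment> \<open>Both marginals lie in the ball, so the same \<open>R\<close> bounds their
    moments.\<close>
  have "\<exists>K. compact K \<and> (\<forall>n. measure (\<pi> n) (- K) < e)" if "0 < e" for e
    using c comp \<open>0 \<le> R\<close> \<pi>(1) R[OF P(1)] R[OF Q_ball] that by (rule tight_couplings)
  from prokhorov_skorohod[OF \<pi>_prob \<pi>_sets this]
  obtain r :: "nat \<Rightarrow> nat" and \<Omega> :: "real measure" and Z Z' where r: "strict_mono r"
    and \<Omega>: "prob_space \<Omega>" and Z[measurable]: "\<And>n. Z n \<in> borel_measurable \<Omega>"
    and Z'[measurable]: "Z' \<in> borel_measurable \<Omega>"
    and distr_Z: "\<And>n. distr \<Omega> borel (Z n) = \<pi> (r n)"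
    and lim_Z: "AE \<omega> in \<Omega>. (\<lambda>n. Z n \<omega>) \<longlonglongrightarrow> Z' \<omega>"
    by blast
  interpret \<Omega>: prob_space \<Omega> by fact
  define X where "X n \<omega> = fst (Z n \<omega>)" for n \<omega>
  define X' where "X' \<omega> = fst (Z' \<omega>)" for \<omega>
  have [measurable]: "X n \<in> borel_measurable \<Omega>" "X' \<in> borel_measurable \<Omega>" for n
    unfolding X_def X'_def by measurable
  have distr_X: "distr \<Omega> borel (X n) = P (r n)" for n
    unfolding X_def \<pi>_fst[symmetric] distr_Z[symmetric] by (simp add: distr_distr comp_def)
  have distr_snd: "distr \<Omega> borel (\<lambda>\<omega>. snd (Z n \<omega>)) = Q" for n
    using \<pi>_snd[of "r n"] unfolding distr_Z[symmetric] by (simp add: distr_distr comp_def)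
  have lim_X: "AE \<omega> in \<Omega>. (\<lambda>n. X n \<omega>) \<longlonglongrightarrow> X' \<omega>"
    using lim_Z unfolding X_def X'_def by eventually_elim (rule tendsto_fst)
  define \<pi>' where "\<pi>' = distr \<Omega> borel Z'"
  define P' where "P' = distr \<Omega> borel X'"
  have "distr \<Omega> borel (\<lambda>\<omega>. snd (Z' \<omega>)) = Q"
    using \<Omega> by (rule distr_eq_of_AE_lim[where Y = "\<lambda>n \<omega>. snd (Z n \<omega>)"])
      (use lim_Z distr_snd in \<open>auto elim!: eventually_mono intro: tendsto_snd\<close>)
  then have \<pi>'_coupling: "\<pi>' \<in> couplings P' Q"
    unfolding couplings_def \<pi>'_def P'_def X'_def
    by (auto simp: distr_distr comp_def intro!: \<Omega>.prob_space_distr)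
  \<comment> \<open>Lower semicontinuity of \<open>c\<close> along the almost surely convergent
    pairs, followed by Fatou's lemma.\<close>
  have "(\<integral>\<^sup>+ z. ennreal (c (fst z) (snd z)) \<partial>\<pi>') = (\<integral>\<^sup>+ \<omega>. ennreal (c (fst (Z' \<omega>)) (snd (Z' \<omega>))) \<partial>\<Omega>)"
    unfolding \<pi>'_def by (rule nn_integral_distr) measurable
  also have "\<dots> \<le> (\<integral>\<^sup>+ \<omega>. liminf (\<lambda>n. ennreal (c (fst (Z n \<omega>)) (snd (Z n \<omega>)))) \<partial>\<Omega>)"
    using lim_Z
    by (intro nn_integral_mono_AE) (auto elim!: eventually_mono intro: lsc_cost_le_liminf[OF lsc] tendsto_fst tendsto_snd)
  also have "\<dots> \<le> liminf (\<lambda>n. \<integral>\<^sup>+ \<omega>. ennreal (c (fst (Z n \<omega>)) (snd (Z n \<omega>))) \<partial>\<Omega>)"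
    by (rule nn_integral_liminf) measurable
  also have "\<dots> \<le> liminf (\<lambda>n. ennreal (\<rho> + inverse (real (Suc n))))"
  proof (intro Liminf_mono always_eventually allI)
    fix n
    have "(\<integral>\<^sup>+ \<omega>. ennreal (c (fst (Z n \<omega>)) (snd (Z n \<omega>))) \<partial>\<Omega>) = (\<integral>\<^sup>+ z. ennreal (c (fst z) (snd z)) \<partial>\<pi> (r n))"
      unfolding distr_Z[symmetric] by (rule nn_integral_distr[symmetric]) measurable
    also have "\<dots> \<le> ennreal (\<rho> + inverse (real (Suc (r n))))"
      by (rule \<pi>)
    also have "\<dots> \<le> ennreal (\<rho> + inverse (real (Suc n)))"
      using seq_suble[OF r, of n] by (intro ennreal_leI add_left_mono le_imp_inverse_le) auto
    finally show "(\<integral>\<^sup>+ \<omega>. ennreal (c (fst (Z n \<omega>)) (snd (Z n \<omega>))) \<partial>\<Omega>) \<le> ennreal (\<rho> + inverse (real (Suc n)))" .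
  qed
  also have "\<dots> = ennreal \<rho>"
    using tendsto_add[OF tendsto_const[of \<rho>] LIMSEQ_inverse_real_of_nat]
    by (intro lim_imp_Liminf tendsto_ennrealI) auto
  finally have cost: "(\<integral>\<^sup>+ z. ennreal (c (fst z) (snd z)) \<partial>\<pi>') \<le> ennreal \<rho>" .
  \<comment> \<open>Besides the cost bound, the ball requires a finite moment of \<open>P'\<close>,
    which the limiting coupling supplies.\<close>
  have "P' \<in> W_ball c \<rho> Q"
  proof -
    obtain K where "0 < K" and tri: "\<And>x y z. c x y \<le> K * (c x z + c z y)"
      using \<open>weak_triangle c\<close> by (auto simp: weak_triangle_def)
    have "(\<integral>\<^sup>+ x. ennreal (c x0 x) \<partial>P') \<le>
        ennreal K * ((\<integral>\<^sup>+ x. ennreal (c x0 x) \<partial>Q) + (\<integral>\<^sup>+ z. ennreal (c (fst z) (snd z)) \<partial>\<pi>'))"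
      by (rule coupling_moment_bound[OF c \<open>0 < K\<close> tri \<pi>'_coupling])
    also have "\<dots> \<le> ennreal K * (ennreal R + ennreal \<rho>)"
      by (intro mult_left_mono add_mono R Q_ball cost) simp
    also have "\<dots> < \<infinity>"
      by (simp add: ennreal_mult_less_top)
    finally have "P' \<in> P_c c"
      unfolding P_c_def prob_borel_def P'_def by (auto intro!: \<Omega>.prob_space_distr)
    moreover have "W_cost c P' Q \<le> ennreal \<rho>"
      unfolding W_cost_def using \<pi>'_coupling cost by (rule INF_lower2)
    ultimately show ?thesis
      by (simp add: W_ball_def)
  qed
  moreover have "S_val c \<rho> Q l \<le> ?J P'"
  proof -
    let ?\<Omega>n = "Pi\<^sub>M UNIV (\<lambda>_::'n. \<Omega>)"
    note qint_X = qint_PiM_distr[OF \<Omega> _ l(1)]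
    have "S_val c \<rho> Q l \<le> qint ?\<Omega>n (\<lambda>\<omega>. l (\<lambda>i. X' (\<omega> i)))"
    proof (rule qint_reverse_Fatou)
      show "prob_space ?\<Omega>n"
        using \<Omega> by (intro prob_space_PiM)
      show "(\<lambda>\<omega>. l (\<lambda>i. X n (\<omega> i))) \<in> borel_measurable ?\<Omega>n" for n
        by (rule qint_X) measurable
      show "(\<lambda>\<omega>. l (\<lambda>i. X' (\<omega> i))) \<in> borel_measurable ?\<Omega>n"
        by (rule qint_X) measurable
      \<comment> \<open>The finitely many coordinates each have law \<open>\<Omega>\<close>, so the
        exceptional null sets can be united.\<close>
      have "AE \<omega> in ?\<Omega>n. \<forall>i\<in>UNIV. (\<lambda>n. X n (\<omega> i)) \<longlonglongrightarrow> X' (\<omega> i)"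
        using \<Omega> lim_X by (intro eventually_ball_finite finite_UNIV ballI AE_PiM_component) auto
      then show "AE \<omega> in ?\<Omega>n. \<forall>t. l (\<lambda>i. X' (\<omega> i)) < t \<longrightarrow>
          eventually (\<lambda>n. l (\<lambda>i. X n (\<omega> i)) < t) sequentially"
      proof eventually_elim
        case (elim \<omega>)
        then have "(\<lambda>n i. X n (\<omega> i)) \<longlonglongrightarrow> (\<lambda>i. X' (\<omega> i))"
          by (intro tendsto_componentwise_fun) auto
        then show ?case
          using usc_eventually_less[OF l(2)] by blast
      qed
      show "(\<lambda>n. qint ?\<Omega>n (\<lambda>\<omega>. l (\<lambda>i. X n (\<omega> i)))) \<longlonglongrightarrow> S_val c \<rho> Q l"
      proof -
        have "qint ?\<Omega>n (\<lambda>\<omega>. l (\<lambda>i. X n (\<omega> i))) = ?J (P (r n))" for n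
          unfolding distr_X[symmetric] by (rule qint_X(1)[symmetric]) measurable
        then show ?thesis
          using LIMSEQ_subseq_LIMSEQ[OF lim_J r] by (simp add: comp_def)
      qed
      fix e :: real assume "0 < e"
      define D where "D = (1 + R) ^ CARD('n)"
      have "0 < D" using \<open>0 \<le> R\<close> by (simp add: D_def)
      \<comment> \<open>Since \<open>D\<close> bounds the integral of the product majorant, this
        choice gives \<open>C * \<eta> * D = e\<close>.\<close>
      define \<eta> where "\<eta> = e / (C * D)"
      have "0 < \<eta>" using \<open>0 < e\<close> \<open>0 < C\<close> \<open>0 < D\<close> by (simp add: \<eta>_def)
      obtain T where "0 \<le> T" and T: "\<And>x :: 'n \<Rightarrow> real. (\<And>k. 0 \<le> x k) \<Longrightarrow>
          (\<Prod>k\<in>UNIV. 1 + \<delta> (x k)) \<le> \<eta> * (\<Prod>k\<in>UNIV. 1 + x k) + T"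
        using prod_D_class_bound[OF \<open>\<delta> \<in> D_class\<close> \<open>0 < \<eta>\<close>] by blast
      have "(\<integral>\<^sup>+ \<omega>. ennreal (l (\<lambda>i. X n (\<omega> i)) - C * T) \<partial>?\<Omega>n) \<le> ennreal e" for n
      proof -
        \<comment> \<open>The constant part of the product bound becomes the truncation level
          \<open>C * T\<close>, which is the same for all \<open>n\<close>.\<close>
        have le: "l (\<lambda>i. X n (\<omega> i)) - C * T \<le> (C * \<eta>) * (\<Prod>k\<in>UNIV. 1 + c x0 (X n (\<omega> k)))" for \<omega> :: "'n \<Rightarrow> real"
        proof -
          have "l (\<lambda>i. X n (\<omega> i)) \<le> C * (\<Prod>k\<in>UNIV. 1 + \<delta> (c x0 (X n (\<omega> k))))"
            by (rule C)
          also have "\<dots> \<le> C * (\<eta> * (\<Prod>k\<in>UNIV. 1 + c x0 (X n (\<omega> k))) + T)"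
            using \<open>0 < C\<close> nonneg by (intro mult_left_mono T) auto
          finally show ?thesis by (simp add: algebra_simps)
        qed
        have moment: "(\<integral>\<^sup>+ \<omega>. ennreal (c x0 (X n \<omega>)) \<partial>\<Omega>) \<le> ennreal R"
          using R[OF P(1)[of "r n"]] unfolding distr_X[symmetric] by (simp add: nn_integral_distr)
        have "(\<integral>\<^sup>+ \<omega>. ennreal (l (\<lambda>i. X n (\<omega> i)) - C * T) \<partial>?\<Omega>n)
            \<le> (\<integral>\<^sup>+ \<omega>. ennreal (C * \<eta>) * ennreal (\<Prod>k\<in>UNIV. 1 + c x0 (X n (\<omega> k))) \<partial>?\<Omega>n)"
          using le \<open>0 < C\<close> \<open>0 < \<eta>\<close> by (intro nn_integral_mono) (simp add: ennreal_leI flip: ennreal_mult')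
        also have "\<dots> = ennreal (C * \<eta>) * (\<integral>\<^sup>+ \<omega>. ennreal (\<Prod>k\<in>UNIV. 1 + c x0 (X n (\<omega> k))) \<partial>?\<Omega>n)"
          by (rule nn_integral_cmult) measurable
        also have "\<dots> \<le> ennreal (C * \<eta>) * ennreal D"
          unfolding D_def
          by (intro mult_left_mono nn_integral_PiM_prod_le[where f = "\<lambda>\<omega>. c x0 (X n \<omega>)"] \<Omega> nonneg \<open>0 \<le> R\<close> moment) auto
        also have "\<dots> = ennreal e"
          using \<open>0 < C\<close> \<open>0 < D\<close> \<open>0 < e\<close> by (simp add: \<eta>_def flip: ennreal_mult')
        finally show ?thesis .
      qed
      then show "\<exists>T\<ge>0. \<forall>n. (\<integral>\<^sup>+ \<omega>. ennreal (l (\<lambda>i. X n (\<omega> i)) - T) \<partial>?\<Omega>n) \<le> ennreal e"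
        using \<open>0 < C\<close> \<open>0 \<le> T\<close> by (intro exI[of _ "C * T"]) auto
    qed
    also have "\<dots> = ?J P'"
      unfolding P'_def by (rule qint_X(1)[symmetric]) measurable
    finally show ?thesis .
  qed
  moreover have "?J P' \<le> S_val c \<rho> Q l"
    unfolding S_val_def using \<open>P' \<in> W_ball c \<rho> Q\<close> by (rule SUP_upper)
  ultimately show ?thesis
    by (intro bexI[of _ P'] antisym)
qed

theorem mainTheorem4:
  fixes c :: "'a::polish_space \<Rightarrow> 'a \<Rightarrow> real"
    and Phat :: "'a measure"
    and \<rho> :: real
    and l :: "('n::finite \<Rightarrow> 'a) \<Rightarrow> real"
  assumes "transport_cost c"
    and "Phat \<in> P_c c"
    and "\<rho> > 0"
    and "l \<in> borel_measurable borel"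
  shows "(weak_triangle c \<and> l \<in> G_hat c \<longrightarrow> S_val c \<rho> Phat l < \<infinity>)
    \<and> (proper_cost c \<and> usc l \<and> l \<in> G_hat_lt c \<longrightarrow>
         (\<exists>P\<in>W_ball c \<rho> Phat. qint (Pi\<^sub>M UNIV (\<lambda>_::'n. P)) l = S_val c \<rho> Phat l))"
  using S_val_finite[OF assms(1) _ assms(2,3,4)] S_val_attained[OF assms(1) _ assms(2,3,4)] by blast

end
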